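(* Up to replacing a code by its opposite code, the following hold. 1. For any $n$, if $C$ is a completely regular code in $J(n,3)$ with covering radius $2$ and strength $1$, then the code $C'=\{x: |x|=2,\ \exists y\in C,\ x\subseteq y\}$ is a code of type (GP.4) in $J(n,2)$, i.e. there is a partition of $\{1,\dots,n\}$ into $q\ge 2$ subsets $Y_1,\dots,Y_q$ of equal size $p\ge 3$ such that $C'=\{x: |x|=2,\ \exists i,\ x\subseteq Y_i\}$. 2. For any $n$, the only completely regular codes in $J(n,3)$ with covering radius $2$ and strength $1$ are codes of type (GP.2), i.e. codes of the form $C=\{x: |x|=3,\ \exists i,\ x\subseteq Y_i\}$ for a partition of $\{1,\dots,n\}$ into $q\ge 3$ subsets $Y_1,\dots,Y_q$ of equal size $p\ge 3$. 3. For any $w\ge 4$ there are no completely regular codes in $J(n,w)$ with covering radius $w-1$ and strength $1$.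
   Context: The Johnson graph $J(n,w)$ has as vertices the $w$-subsets of $\{1,\dots,n\}$, two being adjacent iff they meet in a $(w-1)$-subset; it is assumed that $w\le n/2$. For a code (vertex subset) $C$, $C_i$ is the set of vertices at distance exactly $i$ from $C$, the covering radius $\rho$ is the largest $i$ with $C_i\neq\emptyset$, and the opposite code of $C$ is $C_\rho$. $C$ is completely regular if there are numbers $\alpha_i,\beta_i,\gamma_i$ such that each vertex of $C_i$ has exactly $\alpha_i,\beta_i,\gamma_i$ neighbours in $C_i,C_{i+1},C_{i-1}$ respectively. The strength of a collection $D$ of $w$-subsets is the largest $t$ such that every $t$-subset of $\{1,\dots,n\}$ is contained in the same number of members of $D$. *)

theory Defs
  imports "HOL-Library.Disjoint_Sets"
begin

definition johnson_vertices :: "nat \<Rightarrow> nat \<Rightarrow> nat set set" where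
  "johnson_vertices n w = {x. x \<subseteq> {1..n} \<and> card x = w}"

definition johnson_edges :: "nat \<Rightarrow> nat \<Rightarrow> (nat set \<times> nat set) set" where
  "johnson_edges n w =
     {(x, y). x \<in> johnson_vertices n w \<and> y \<in> johnson_vertices n w \<and> card (x \<inter> y) + 1 = w}"

(* Path distance; meaningful for vertices in the same component (Johnson graphs are connected). *)
definition graph_dist :: "('a \<times> 'a) set \<Rightarrow> 'a \<Rightarrow> 'a \<Rightarrow> nat" where
  "graph_dist E x y = (LEAST k. (x, y) \<in> E ^^ k)"

(* Min is unspecified on the empty set; completely_regular below requires C to be nonempty. *)
definition layer :: "nat \<Rightarrow> nat \<Rightarrow> nat set set \<Rightarrow> nat \<Rightarrow> nat set set" where
  "layer n w C i = {x \<in> johnson_vertices n w. Min (graph_dist (johnson_edges n w) x ` C) = i}"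

definition covering_radius :: "nat \<Rightarrow> nat \<Rightarrow> nat set set \<Rightarrow> nat" where
  "covering_radius n w C = Max {i. layer n w C i \<noteq> {}}"

definition opposite_code :: "nat \<Rightarrow> nat \<Rightarrow> nat set set \<Rightarrow> nat set set" where
  "opposite_code n w C = layer n w C (covering_radius n w C)"

definition nbrs_in :: "nat \<Rightarrow> nat \<Rightarrow> nat set \<Rightarrow> nat set set \<Rightarrow> nat set set" where
  "nbrs_in n w x S = {y \<in> S. (x, y) \<in> johnson_edges n w}"

(* There is no layer below C itself, so no condition is imposed on gamma at i = 0. *)
definition completely_regular :: "nat \<Rightarrow> nat \<Rightarrow> nat set set \<Rightarrow> bool" where
  "completely_regular n w C \<longleftrightarrow>
     C \<subseteq> johnson_vertices n w \<and> C \<noteq> {} \<and>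
     (\<exists>\<alpha> \<beta> \<gamma> :: nat \<Rightarrow> nat. \<forall>i. \<forall>x \<in> layer n w C i.
        card (nbrs_in n w x (layer n w C i)) = \<alpha> i \<and>
        card (nbrs_in n w x (layer n w C (i + 1))) = \<beta> i \<and>
        (i > 0 \<longrightarrow> card (nbrs_in n w x (layer n w C (i - 1))) = \<gamma> i))"

definition is_design :: "nat \<Rightarrow> nat \<Rightarrow> nat set set \<Rightarrow> bool" where
  "is_design n t D \<longleftrightarrow>
     (\<exists>l::nat. \<forall>T. T \<subseteq> {1..n} \<and> card T = t \<longrightarrow> card {x \<in> D. T \<subseteq> x} = l)"

(* For t > w no t-subset lies in a w-subset, so the condition is vacuous there; hence t \<le> w. *)
definition strength :: "nat \<Rightarrow> nat \<Rightarrow> nat set set \<Rightarrow> nat" where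
  "strength n w D = Max {t. t \<le> w \<and> is_design n t D}"

definition equipartition :: "nat \<Rightarrow> nat \<Rightarrow> nat \<Rightarrow> nat set set \<Rightarrow> bool" where
  "equipartition n q p P \<longleftrightarrow> partition_on {1..n} P \<and> card P = q \<and> (\<forall>Y \<in> P. card Y = p)"

definition type_GP2 :: "nat \<Rightarrow> nat set set \<Rightarrow> bool" where
  "type_GP2 n C \<longleftrightarrow>
     (\<exists>q p P. q \<ge> 3 \<and> p \<ge> 3 \<and> equipartition n q p P \<and>
        C = {x. card x = 3 \<and> (\<exists>Y \<in> P. x \<subseteq> Y)})"

definition type_GP4 :: "nat \<Rightarrow> nat set set \<Rightarrow> bool" where
  "type_GP4 n C \<longleftrightarrow>
     (\<exists>q p P. q \<ge> 2 \<and> p \<ge> 3 \<and> equipartition n q p P \<and>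
        C = {x. card x = 2 \<and> (\<exists>Y \<in> P. x \<subseteq> Y)})"

definition pair_shadow :: "nat set set \<Rightarrow> nat set set" where
  "pair_shadow C = {x. card x = 2 \<and> (\<exists>y \<in> C. x \<subseteq> y)}"

end

(*
  Colour each w-set by its distance from C, using 0, ..., w-1. Let theta_0, ..., theta_w be the
  eigenvalues of J(n,w). As C is a 1-design, applying the shifts A - theta_0, A - theta_2, ...,
  A - theta_(w-1) to the indicator function of C gives a function that depends only on the colour,
  is non-zero on every colour, and sums to zero over the supersets of every (w-1)-set. Hence the
  w-sets above a (w-1)-set a have exactly two colours i and i+1, each a number of times that depends
  only on i. Giving a the colour i defines a colouring of J(n,w-1) with the same properties.

  For w = 3 this produces a regular graph on the points in which all triples of colour 1 have the
  same number of edges, either 1 or 2. So no triple spans exactly two edges in the graph or none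
  does in its complement, and that graph is a disjoint union of cliques of equal size. For w = 4 the
  resulting structure on triples is contradictory, and larger w descend to w = 4.
*)

theory Submission
  imports Defs
begin

section \<open>Moves and distances in the Johnson graph\<close>

definition moves :: "nat \<Rightarrow> nat set \<Rightarrow> (nat \<times> nat) set" where
  "moves n x = x \<times> ({1..n} - x)"

definition exchange :: "nat set \<Rightarrow> nat \<times> nat \<Rightarrow> nat set" where
  "exchange x m = insert (snd m) (x - {fst m})"

lemma johnson_vertices_finite [simp]: "finite (johnson_vertices n w)"
  by (rule finite_subset[of _ "Pow {1..n}"]) (auto simp: johnson_vertices_def)

lemma finite_vertex: "x \<in> johnson_vertices n w \<Longrightarrow> finite x"
  by (auto simp: johnson_vertices_def intro: finite_subset)

lemma vertex_subset_eq:
  "x \<in> johnson_vertices n w \<Longrightarrow> y \<in> johnson_vertices n w \<Longrightarrow> x \<subseteq> y \<Longrightarrow> x = y"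
  using finite_vertex[of y n w] card_subset_eq[of y x] by (simp add: johnson_vertices_def)

lemma finite_moves: "x \<in> johnson_vertices n w \<Longrightarrow> finite (moves n x)"
  by (simp add: moves_def finite_vertex)

lemma exchange_vertex:
  assumes "x \<in> johnson_vertices n w" "m \<in> moves n x"
  shows "exchange x m \<in> johnson_vertices n w"
proof -
  have "card (insert (snd m) (x - {fst m})) = w"
    using assms finite_vertex[OF assms(1)]
    by (auto simp: moves_def johnson_vertices_def card_insert_if) (metis Suc_pred card_gt_0_iff empty_iff)
  then show ?thesis
    using assms by (auto simp: moves_def johnson_vertices_def exchange_def)
qed

lemma exchange_edge:
  assumes "x \<in> johnson_vertices n w" "m \<in> moves n x"
  shows "(x, exchange x m) \<in> johnson_edges n w"
proof -
  have "x \<inter> exchange x m = x - {fst m}"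
    using assms by (auto simp: moves_def exchange_def)
  moreover have "card (x - {fst m}) + 1 = w"
    using assms finite_vertex[OF assms(1)] card_Suc_Diff1[of x "fst m"]
    by (auto simp: moves_def johnson_vertices_def)
  ultimately show ?thesis
    using assms exchange_vertex[OF assms] by (simp add: johnson_edges_def)
qed

lemma edge_exchange:
  assumes "(x, y) \<in> johnson_edges n w"
  obtains m where "m \<in> moves n x" "y = exchange x m"
proof -
  have x: "x \<in> johnson_vertices n w" and y: "y \<in> johnson_vertices n w" and c: "card (x \<inter> y) + 1 = w"
    using assms by (auto simp: johnson_edges_def)
  have fin: "finite x" "finite y" using x y finite_vertex by auto
  have "card (x - y) = 1" "card (y - x) = 1"
    using c x y fin card_Diff_subset_Int[of x y] card_Diff_subset_Int[of y x]
    by (auto simp: johnson_vertices_def Int_commute)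
  then obtain u v where uv: "x - y = {u}" "y - x = {v}"
    by (metis card_1_singletonE)
  then have "y = exchange x (u, v)" by (auto simp: exchange_def)
  moreover have "(u, v) \<in> moves n x" using uv y by (auto simp: moves_def johnson_vertices_def)
  ultimately show ?thesis using that by blast
qed

lemma exchange_inverse:
  "m \<in> moves n x \<Longrightarrow> prod.swap m \<in> moves n (exchange x m) \<and> exchange (exchange x m) (prod.swap m) = x"
  if "x \<subseteq> {1..n}"
  using that by (auto simp: moves_def exchange_def)

lemma exchange_Diff:
  "m \<in> moves n x \<Longrightarrow> x - exchange x m = {fst m}"
  "m \<in> moves n x \<Longrightarrow> exchange x m - x = {snd m}"
  by (auto simp: moves_def exchange_def)

lemma inj_on_exchange: "inj_on (exchange x) (moves n x)"
proof (rule inj_onI)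
  fix m m' assume "m \<in> moves n x" "m' \<in> moves n x" "exchange x m = exchange x m'"
  then have "{fst m} = {fst m'}" "{snd m} = {snd m'}"
    using exchange_Diff by metis+
  then show "m = m'" by (simp add: prod_eq_iff)
qed

lemma card_neighbours:
  assumes "x \<in> johnson_vertices n w"
  shows "card {y. (x, y) \<in> johnson_edges n w \<and> Q y} = card {m \<in> moves n x. Q (exchange x m)}"
proof -
  have "{y. (x, y) \<in> johnson_edges n w \<and> Q y} = exchange x ` {m \<in> moves n x. Q (exchange x m)}"
    using exchange_edge[OF assms] by (auto elim: edge_exchange)
  moreover have "inj_on (exchange x) {m \<in> moves n x. Q (exchange x m)}"
    using inj_on_exchange by (rule inj_on_subset) auto
  ultimately show ?thesis by (simp only: card_image)
qed

lemma johnson_edges_sym: "(x, y) \<in> johnson_edges n w \<Longrightarrow> (y, x) \<in> johnson_edges n w"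
  by (auto simp: johnson_edges_def Int_commute)

lemma edge_card_Diff:
  assumes "(x, y) \<in> johnson_edges n w"
  shows "card (x - y) = 1"
proof -
  obtain m where "m \<in> moves n x" "y = exchange x m" using edge_exchange[OF assms] .
  then have "x - y = {fst m}" by (auto simp: moves_def exchange_def)
  then show ?thesis by simp
qed

lemma card_Diff_triangle:
  assumes "finite x" "finite y"
  shows "card (x - z) \<le> card (x - y) + card (y - z)"
proof -
  have "card (x - z) \<le> card ((x - y) \<union> (y - z))"
    using assms by (intro card_mono) auto
  also have "\<dots> \<le> card (x - y) + card (y - z)" by (rule card_Un_le)
  finally show ?thesis .
qed

lemma relpow_card_Diff_le:
  "(x, y) \<in> johnson_edges n w ^^ k \<Longrightarrow> card (x - y) \<le> k"
proof (induction k arbitrary: y)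
  case 0
  then show ?case by simp
next
  case (Suc k)
  then obtain z where z: "(x, z) \<in> johnson_edges n w ^^ k" "(z, y) \<in> johnson_edges n w" by auto
  have fz: "finite z" using z(2) finite_vertex by (auto simp: johnson_edges_def)
  have "x = z \<or> finite x"
  proof (cases k)
    case 0
    then show ?thesis using z by simp
  next
    case (Suc k')
    then show ?thesis using z(1) finite_vertex
      by (metis (no_types, lifting) johnson_edges_def mem_Collect_eq case_prodD relpow_Suc_D2)
  qed
  then have "card (x - y) \<le> card (x - z) + card (z - y)"
    using card_Diff_triangle fz by blast
  then show ?case using Suc.IH[OF z(1)] edge_card_Diff[OF z(2)] by simp
qed

lemma exists_closer:
  assumes x: "x \<in> johnson_vertices n w" and y: "y \<in> johnson_vertices n w" and k: "card (x - y) = Suc k"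
  obtains z where "(x, z) \<in> johnson_edges n w" "card (z - y) = k"
proof -
  have fin: "finite x" "finite y" using x y finite_vertex by auto
  have "card (y - x) = card (x - y)"
    using x y fin card_Diff_subset_Int[of x y] card_Diff_subset_Int[of y x]
    by (simp add: johnson_vertices_def Int_commute)
  then obtain u v where uv: "u \<in> x - y" "v \<in> y - x"
    using k by (metis card.empty ex_in_conv nat.distinct(1))
  have m: "(u, v) \<in> moves n x" using uv y by (auto simp: moves_def johnson_vertices_def)
  have "exchange x (u, v) - y = (x - y) - {u}" using uv by (auto simp: exchange_def)
  then have "card (exchange x (u, v) - y) = k" using uv k fin by simp
  then show ?thesis using that exchange_edge[OF x m] by blast
qed

lemma relpow_card_Diff:
  assumes "x \<in> johnson_vertices n w" "y \<in> johnson_vertices n w"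
  shows "(x, y) \<in> johnson_edges n w ^^ card (x - y)"
  using assms
proof (induction "card (x - y)" arbitrary: x)
  case 0
  then have "x \<subseteq> y" using finite_vertex by (metis Diff_eq_empty_iff card_0_eq finite_Diff)
  then have "x = y" using 0 vertex_subset_eq by blast
  then show ?case by simp
next
  case (Suc k)
  obtain z where z: "(x, z) \<in> johnson_edges n w" "card (z - y) = k"
    using exists_closer[of x n w y k] Suc by metis
  have "z \<in> johnson_vertices n w" using z by (auto simp: johnson_edges_def)
  then have "(z, y) \<in> johnson_edges n w ^^ k" using Suc.hyps(1)[of z] Suc.prems z by simp
  then show ?case using z(1) Suc.hyps(2) relpow_Suc_I2 by metis
qed

lemma graph_dist_johnson:
  assumes "x \<in> johnson_vertices n w" "y \<in> johnson_vertices n w"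
  shows "graph_dist (johnson_edges n w) x y = card (x - y)"
  unfolding graph_dist_def
  using relpow_card_Diff[OF assms] relpow_card_Diff_le by (intro Least_equality) auto

definition code_dist :: "nat \<Rightarrow> nat \<Rightarrow> nat set set \<Rightarrow> nat set \<Rightarrow> nat" where
  "code_dist n w C x = Min (graph_dist (johnson_edges n w) x ` C)"

lemma layer_code_dist: "layer n w C i = {x \<in> johnson_vertices n w. code_dist n w C x = i}"
  by (simp add: layer_def code_dist_def)

lemma code_dist_eqI:
  assumes C: "C = {x \<in> johnson_vertices n w. c x = 0}"
    and lip: "\<And>x y. (x, y) \<in> johnson_edges n w \<Longrightarrow> c x \<le> c y + 1"
    and desc: "\<And>x. x \<in> johnson_vertices n w \<Longrightarrow> c x > 0 \<Longrightarrow> \<exists>y. (x, y) \<in> johnson_edges n w \<and> c y + 1 = c x"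
    and x: "x \<in> johnson_vertices n w"
  shows "code_dist n w C x = c x"
proof -
  have low: "c x \<le> c y + k" if "(x, y) \<in> johnson_edges n w ^^ k" for x y k
    using that
  proof (induction k arbitrary: y)
    case (Suc k)
    then obtain z where "(x, z) \<in> johnson_edges n w ^^ k" "(z, y) \<in> johnson_edges n w" by auto
    then show ?case using Suc.IH lip by fastforce
  qed simp
  have "\<exists>y \<in> C. (x, y) \<in> johnson_edges n w ^^ c x"
    using x
  proof (induction "c x" arbitrary: x)
    case 0
    then have "x \<in> C" using C by auto
    then show ?case using 0 by (intro bexI[of _ x]) auto
  next
    case (Suc k)
    then obtain z where z: "(x, z) \<in> johnson_edges n w" "c z + 1 = c x" using desc[of x] by auto
    have "z \<in> johnson_vertices n w" using z(1) by (simp add: johnson_edges_def)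
    moreover have k: "c z = k" using z(2) Suc.hyps(2) by simp
    ultimately obtain y where y: "y \<in> C" "(z, y) \<in> johnson_edges n w ^^ k"
      using Suc.hyps(1)[of z] by auto
    have "(x, y) \<in> johnson_edges n w ^^ Suc k" using z(1) y(2) by (rule relpow_Suc_I2)
    then show ?case using y(1) Suc.hyps(2) by metis
  qed
  then obtain y where y: "y \<in> C" "(x, y) \<in> johnson_edges n w ^^ c x" by blast
  have ge: "c x \<le> graph_dist (johnson_edges n w) x y'" if "y' \<in> C" for y'
  proof -
    have y': "y' \<in> johnson_vertices n w" "c y' = 0" using that C by auto
    show ?thesis
      using low[OF relpow_card_Diff[OF x y'(1)]] y'(2) graph_dist_johnson[OF x y'(1)] by simp
  qed
  have "graph_dist (johnson_edges n w) x y \<le> c x"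
    unfolding graph_dist_def using y(2) by (rule Least_le)
  then have "graph_dist (johnson_edges n w) x y = c x" using ge[OF y(1)] by simp
  moreover have "finite C" using C by simp
  ultimately show ?thesis unfolding code_dist_def
    using y(1) ge by (intro Min_eqI) (auto intro: rev_image_eqI)
qed

context
  fixes n w :: nat and C :: "nat set set"
  assumes sub: "C \<subseteq> johnson_vertices n w" and ne: "C \<noteq> {}"
begin

lemma finite_code: "finite C"
  using sub by (rule finite_subset) simp

lemma code_dist_le:
  assumes "x \<in> johnson_vertices n w" "y \<in> C"
  shows "code_dist n w C x \<le> card (x - y)"
  using assms sub graph_dist_johnson[of x n w y] finite_code
  by (auto simp: code_dist_def intro!: Min_le rev_image_eqI)

lemma code_dist_attained:
  assumes "x \<in> johnson_vertices n w"
  obtains y where "y \<in> C" "code_dist n w C x = card (x - y)"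
proof -
  have "code_dist n w C x \<in> graph_dist (johnson_edges n w) x ` C"
    unfolding code_dist_def using finite_code ne by (intro Min_in) auto
  then show ?thesis using that graph_dist_johnson[OF assms] sub by auto
qed

lemma code_dist_lipschitz:
  assumes e: "(x, y) \<in> johnson_edges n w"
  shows "code_dist n w C y \<le> code_dist n w C x + 1"
proof -
  have x: "x \<in> johnson_vertices n w" and y: "y \<in> johnson_vertices n w"
    using e by (auto simp: johnson_edges_def)
  obtain z where z: "z \<in> C" "code_dist n w C x = card (x - z)" using code_dist_attained[OF x] .
  have "code_dist n w C y \<le> card (y - z)" using code_dist_le[OF y z(1)] .
  moreover have "card (y - z) \<le> card (y - x) + card (x - z)"
    using finite_vertex[OF x] finite_vertex[OF y] by (intro card_Diff_triangle)
  moreover have "card (y - x) = 1" using johnson_edges_sym[OF e] by (rule edge_card_Diff)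
  ultimately show ?thesis using z(2) by linarith
qed

lemma code_dist_descent:
  assumes x: "x \<in> johnson_vertices n w" and pos: "code_dist n w C x > 0"
  shows "\<exists>y. (x, y) \<in> johnson_edges n w \<and> code_dist n w C y + 1 = code_dist n w C x"
proof -
  obtain z where z: "z \<in> C" "code_dist n w C x = card (x - z)" using code_dist_attained[OF x] .
  then obtain k where k: "card (x - z) = Suc k" using pos by (metis gr0_implies_Suc)
  obtain y where y: "(x, y) \<in> johnson_edges n w" "card (y - z) = k"
    using exists_closer[OF x _ k] z sub by blast
  have "code_dist n w C y \<le> k"
    using code_dist_le[of y z] y z by (auto simp: johnson_edges_def)
  moreover have "code_dist n w C x \<le> code_dist n w C y + 1"
    using code_dist_lipschitz[OF johnson_edges_sym[OF y(1)]] .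
  ultimately show ?thesis using y z k by (intro exI[of _ y]) auto
qed

lemma code_dist_0_iff:
  assumes x: "x \<in> johnson_vertices n w"
  shows "code_dist n w C x = 0 \<longleftrightarrow> x \<in> C"
proof
  assume "x \<in> C"
  then show "code_dist n w C x = 0" using code_dist_le[OF x, of x] by simp
next
  assume 0: "code_dist n w C x = 0"
  obtain z where z: "z \<in> C" "code_dist n w C x = card (x - z)" using code_dist_attained[OF x] .
  then have "x \<subseteq> z" using 0 x finite_vertex by (metis Diff_eq_empty_iff card_0_eq finite_Diff)
  then have "x = z" using x z sub vertex_subset_eq by blast
  then show "x \<in> C" using z by simp
qed

lemma code_dist_le_card:
  assumes "x \<in> johnson_vertices n w"
  shows "code_dist n w C x \<le> w"
proof -
  obtain z where "code_dist n w C x = card (x - z)" using code_dist_attained[OF assms] .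
  then show ?thesis using assms finite_vertex[OF assms] card_mono[of x "x - z"]
    by (auto simp: johnson_vertices_def)
qed

end

section \<open>Colourings and weights with vanishing sums\<close>

lemma card_pos: "finite A \<Longrightarrow> a \<in> A \<Longrightarrow> card A > 0"
  by (auto simp: card_gt_0_iff)

lemma johnson_vertices_leD: "x \<in> johnson_vertices n w \<Longrightarrow> w \<le> n"
  using card_mono[of "{1..n}" x] by (auto simp: johnson_vertices_def)

lemma card_moves_superset:
  fixes n w j :: nat
  assumes y: "y \<in> johnson_vertices n w" and T: "T \<subseteq> {1..n}" "card T = j"
  shows "int (card {m \<in> moves n y. T \<subseteq> exchange y m}) =
    (if T \<subseteq> y then (int w - int j) * (int n - int w - int j) - int j else 0)
      + (int w - int j + 1) * int (card {s \<in> T. T - {s} \<subseteq> y})"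
proof -
  have fin: "finite y" "finite T" using finite_vertex[OF y] finite_subset[OF T(1)] by simp_all
  have yX: "y \<subseteq> {1..n}" "card y = w" using y by (auto simp: johnson_vertices_def)
  have cX: "card ({1..n} - y) = n - w" using yX fin by (simp add: card_Diff_subset)
  have wn: "w \<le> n" using johnson_vertices_leD[OF y] .
  consider "T \<subseteq> y" | t where "T - y = {t}" | "\<not> T \<subseteq> y" "\<And>t. T - y \<noteq> {t}" by blast
  then show ?thesis
  proof cases
    case 1
    have "{m \<in> moves n y. T \<subseteq> exchange y m} = (y - T) \<times> ({1..n} - y)"
      using 1 by (auto simp: moves_def exchange_def)
    moreover have "{s \<in> T. T - {s} \<subseteq> y} = T" using 1 by auto
    moreover have "card (y - T) = w - j" "j \<le> w"
      using 1 fin yX T card_mono[of y T] by (auto simp: card_Diff_subset)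
    ultimately have "int (card {m \<in> moves n y. T \<subseteq> exchange y m}) = (int w - int j) * (int n - int w)"
      "{s \<in> T. T - {s} \<subseteq> y} = T"
      using cX wn by (simp_all add: card_cartesian_product of_nat_diff)
    then show ?thesis using 1 T(2) by (simp add: algebra_simps)
  next
    case 2
    have e: "{m \<in> moves n y. T \<subseteq> exchange y m} = (y - T) \<times> {t}"
      using 2 T by (auto simp: moves_def exchange_def)
    have f: "{s \<in> T. T - {s} \<subseteq> y} = {t}" using 2 by auto
    have "T \<inter> y = T - {t}" using 2 by auto
    moreover have "t \<in> T" using 2 by auto
    ultimately have ci: "card (T \<inter> y) + 1 = j" using fin T card_Suc_Diff1[of T t] by simp
    have "card (y - T) = w - card (T \<inter> y)" "card (T \<inter> y) \<le> w"
      using fin yX card_Diff_subset_Int[of y T] card_mono[of y "T \<inter> y"] by (auto simp: Int_commute)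
    then have "int (card (y - T)) = int w - int j + 1" using ci by linarith
    moreover have "\<not> T \<subseteq> y" using 2 by auto
    ultimately show ?thesis unfolding e f by (simp add: card_cartesian_product)
  next
    case 3
    then have e: "{s \<in> T. T - {s} \<subseteq> y} = {}" by auto
    have "T - y \<subseteq> {snd m}" if "T \<subseteq> exchange y m" for m
      using that by (auto simp: exchange_def)
    then have f: "{m \<in> moves n y. T \<subseteq> exchange y m} = {}" using 3 by blast
    show ?thesis unfolding e f using 3 by simp
  qed
qed

lemma sum_moves_reverse:
  fixes F :: "nat set \<Rightarrow> nat set \<Rightarrow> int"
  shows "(\<Sum>x\<in>johnson_vertices n w. \<Sum>m\<in>moves n x. F x (exchange x m))
    = (\<Sum>y\<in>johnson_vertices n w. \<Sum>m\<in>moves n y. F (exchange y m) y)"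
proof -
  let ?S = "Sigma (johnson_vertices n w) (moves n)"
  let ?g = "\<lambda>(x, m). (exchange x m, prod.swap m)"
  have inv: "?g a \<in> ?S \<and> ?g (?g a) = a" if "a \<in> ?S" for a
  proof -
    obtain x m where a: "a = (x, m)" by (cases a)
    then have "x \<in> johnson_vertices n w" "m \<in> moves n x" using that by auto
    moreover from this have "x \<subseteq> {1..n}" by (simp add: johnson_vertices_def)
    ultimately show ?thesis
      using a exchange_vertex[of x n w m] exchange_inverse[of x n m] by simp
  qed
  have "(\<Sum>(x, m)\<in>?S. F x (exchange x m)) = (\<Sum>(y, m)\<in>?S. F (exchange y m) y)"
    using inv
    by (intro sum.reindex_bij_witness[of ?S ?g ?g]) (auto split: prod.splits)
  then show ?thesis by (simp add: sum.Sigma finite_moves)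
qed

lemma sum_superset_adjacency:
  fixes f :: "nat set \<Rightarrow> int"
  assumes T: "T \<subseteq> {1..n}" "card T = j"
  shows "(\<Sum>x | x \<in> johnson_vertices n w \<and> T \<subseteq> x. \<Sum>m\<in>moves n x. f (exchange x m))
    = ((int w - int j) * (int n - int w - int j) - int j)
        * (\<Sum>x | x \<in> johnson_vertices n w \<and> T \<subseteq> x. f x)
      + (int w - int j + 1) * (\<Sum>s\<in>T. \<Sum>x | x \<in> johnson_vertices n w \<and> T - {s} \<subseteq> x. f x)"
    (is "?L = ?\<theta> * ?A + ?b * ?B")
proof -
  let ?V = "johnson_vertices n w"
  have finT: "finite T" using T finite_subset by blast
  have "?L = (\<Sum>x\<in>?V. \<Sum>m\<in>moves n x. if T \<subseteq> x then f (exchange x m) else 0)"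
    by (auto simp: sum.inter_filter intro!: sum.cong)
  also have "\<dots> = (\<Sum>y\<in>?V. \<Sum>m\<in>moves n y. if T \<subseteq> exchange y m then f y else 0)"
    by (rule sum_moves_reverse)
  also have "\<dots> = (\<Sum>y\<in>?V. f y * int (card {m \<in> moves n y. T \<subseteq> exchange y m}))"
    by (intro sum.cong refl) (simp add: sum.inter_filter[symmetric] finite_moves mult.commute)
  also have "\<dots> = (\<Sum>y\<in>?V. ?\<theta> * (if T \<subseteq> y then f y else 0)
      + ?b * (\<Sum>s\<in>T. if T - {s} \<subseteq> y then f y else 0))"
    by (intro sum.cong refl, subst card_moves_superset[OF _ T])
       (auto simp: sum.inter_filter[symmetric] finT algebra_simps)
  also have "\<dots> = ?\<theta> * ?A + ?b * (\<Sum>y\<in>?V. \<Sum>s\<in>T. if T - {s} \<subseteq> y then f y else 0)"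
    by (simp add: sum.distrib sum_distrib_left[symmetric] sum.inter_filter)
  also have "(\<Sum>y\<in>?V. \<Sum>s\<in>T. if T - {s} \<subseteq> y then f y else 0) = ?B"
    by (subst sum.swap) (simp add: sum.inter_filter)
  finally show ?thesis .
qed

lemma sum_by_value:
  fixes h :: "nat \<Rightarrow> int"
  assumes "finite A" "\<And>a. a \<in> A \<Longrightarrow> f a < w"
  shows "(\<Sum>a\<in>A. h (f a)) = (\<Sum>j<w. int (card {a \<in> A. f a = j}) * h j)"
proof -
  have "(\<Sum>j<w. sum (\<lambda>a. h (f a)) {a \<in> A. f a = j}) = (\<Sum>a\<in>A. h (f a))"
    using assms by (intro sum.group) auto
  moreover have "sum (\<lambda>a. h (f a)) {a \<in> A. f a = j} = int (card {a \<in> A. f a = j}) * h j" for j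
    by simp
  ultimately show ?thesis by simp
qed

locale chain_colouring =
  fixes n w :: nat and c :: "nat set \<Rightarrow> nat"
  assumes colour_less: "x \<in> johnson_vertices n w \<Longrightarrow> c x < w"
    and top_colour: "\<exists>x \<in> johnson_vertices n w. c x + 1 = w"
    and colour_step: "x \<in> johnson_vertices n w \<Longrightarrow> m \<in> moves n x \<Longrightarrow> c (exchange x m) \<le> c x + 1"
    and colour_descent: "x \<in> johnson_vertices n w \<Longrightarrow> c x > 0 \<Longrightarrow>
      \<exists>m \<in> moves n x. c (exchange x m) + 1 = c x"
    and equitable: "x \<in> johnson_vertices n w \<Longrightarrow> y \<in> johnson_vertices n w \<Longrightarrow> c x = c y \<Longrightarrow>
      card {m \<in> moves n x. c (exchange x m) = j} = card {m \<in> moves n y. c (exchange y m) = j}"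
    and design: "\<exists>l. \<forall>p \<in> {1..n}. card {x \<in> johnson_vertices n w. p \<in> x \<and> c x = 0} = l"
begin

lemma colour_step':
  assumes "x \<in> johnson_vertices n w" "m \<in> moves n x"
  shows "c x \<le> c (exchange x m) + 1"
  using colour_step[OF exchange_vertex[OF assms], of "prod.swap m"] exchange_inverse[of x n m] assms
  by (auto simp: johnson_vertices_def)

lemma colour_exists:
  assumes "i < w"
  obtains x where "x \<in> johnson_vertices n w" "c x = i"
proof -
  have "\<exists>x \<in> johnson_vertices n w. c x + k = w" if "1 \<le> k" "k \<le> w" for k
    using that
  proof (induction k rule: dec_induct)
    case base
    then show ?case using top_colour by simp
  next
    case (step k)
    then obtain x where x: "x \<in> johnson_vertices n w" "c x + k = w" by auto
    then have "c x > 0" using step by simp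
    then obtain m where "m \<in> moves n x" "c (exchange x m) + 1 = c x"
      using colour_descent x by blast
    then show ?case using x exchange_vertex by (intro bexI[of _ "exchange x m"]) auto
  qed
  then obtain x where "x \<in> johnson_vertices n w" "c x + (w - i) = w"
    using assms by (metis One_nat_def Suc_leI diff_le_self zero_less_diff)
  then show ?thesis using that assms by auto
qed

definition quotient_entry :: "nat \<Rightarrow> nat \<Rightarrow> nat" where
  "quotient_entry i j =
    (let x = SOME x. x \<in> johnson_vertices n w \<and> c x = i in card {m \<in> moves n x. c (exchange x m) = j})"

lemma quotient_entry:
  assumes "x \<in> johnson_vertices n w"
  shows "card {m \<in> moves n x. c (exchange x m) = j} = quotient_entry (c x) j"
proof -
  have "(SOME y. y \<in> johnson_vertices n w \<and> c y = c x) \<in> johnson_vertices n w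
      \<and> c (SOME y. y \<in> johnson_vertices n w \<and> c y = c x) = c x"
    using assms by (intro someI[of "\<lambda>y. y \<in> johnson_vertices n w \<and> c y = c x" x]) simp
  then show ?thesis using equitable[OF assms] by (simp add: quotient_entry_def Let_def)
qed

definition quotient_shift :: "int \<Rightarrow> (nat \<Rightarrow> int) \<Rightarrow> nat \<Rightarrow> int" where
  "quotient_shift \<theta> h i = (\<Sum>j<w. int (quotient_entry i j) * h j) - \<theta> * h i"

lemma quotient_shift:
  assumes x: "x \<in> johnson_vertices n w"
  shows "quotient_shift \<theta> h (c x) = (\<Sum>m\<in>moves n x. h (c (exchange x m))) - \<theta> * h (c x)"
proof -
  have "(\<Sum>m\<in>moves n x. h (c (exchange x m)))
      = (\<Sum>j<w. int (card {m \<in> moves n x. c (exchange x m) = j}) * h j)"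
    by (rule sum_by_value[OF finite_moves[OF x]]) (simp add: colour_less exchange_vertex[OF x])
  then show ?thesis by (simp add: quotient_shift_def quotient_entry[OF x])
qed

lemma sum_quotient_shift:
  assumes "S \<subseteq> johnson_vertices n w"
  shows "(\<Sum>x\<in>S. quotient_shift \<theta> h (c x))
    = (\<Sum>x\<in>S. \<Sum>m\<in>moves n x. h (c (exchange x m))) - \<theta> * (\<Sum>x\<in>S. h (c x))"
proof -
  have "(\<Sum>x\<in>S. quotient_shift \<theta> h (c x))
      = (\<Sum>x\<in>S. (\<Sum>m\<in>moves n x. h (c (exchange x m))) - \<theta> * h (c x))"
    using assms quotient_shift by (intro sum.cong) auto
  then show ?thesis by (simp add: sum_subtractf sum_distrib_left)
qed

lemma quotient_shift_support:
  assumes supp: "\<And>i. k < i \<Longrightarrow> i < w \<Longrightarrow> h i = 0" and pos: "h k > 0" and k: "Suc k < w"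
  shows "quotient_shift \<theta> h (Suc k) > 0"
    and "\<And>i. Suc k < i \<Longrightarrow> i < w \<Longrightarrow> quotient_shift \<theta> h i = 0"
proof -
  obtain x where x: "x \<in> johnson_vertices n w" "c x = Suc k" using colour_exists[OF k] .
  then obtain m where "m \<in> moves n x" "c (exchange x m) = k" using colour_descent[of x] by auto
  then have "m \<in> {m \<in> moves n x. c (exchange x m) = k}" by simp
  then have "card {m \<in> moves n x. c (exchange x m) = k} > 0"
    by (rule card_pos[rotated]) (simp add: finite_moves[OF x(1)])
  then have "quotient_entry (Suc k) k > 0"
    using quotient_entry[OF x(1), of k] x(2) by simp
  moreover have "(\<Sum>j<w. int (quotient_entry (Suc k) j) * h j) \<ge> int (quotient_entry (Suc k) k) * h k"
  proof -
    have z: "int (quotient_entry (Suc k) j) * h j = 0" if "j < w" "j \<noteq> k" for j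
    proof (cases "j > k")
      case False
      have "{m \<in> moves n x. c (exchange x m) = j} = {}"
        using colour_step'[OF x(1)] x(2) False that(2) by fastforce
      then have "card {m \<in> moves n x. c (exchange x m) = j} = 0" by (simp only: card.empty)
      then have "quotient_entry (Suc k) j = 0" using quotient_entry[OF x(1), of j] x(2) by simp
      then show ?thesis by simp
    qed (simp add: supp that)
    have "(\<Sum>j<w. int (quotient_entry (Suc k) j) * h j)
        = (\<Sum>j<w. if j = k then int (quotient_entry (Suc k) k) * h k else 0)"
      using z by (intro sum.cong) auto
    then show ?thesis using k by simp
  qed
  ultimately show "quotient_shift \<theta> h (Suc k) > 0"
    using pos supp[of "Suc k"] k by (simp add: quotient_shift_def) (meson le_less_trans mult_pos_pos of_nat_0_less_iff order_less_le_trans)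
  show "quotient_shift \<theta> h i = 0" if i: "Suc k < i" "i < w" for i
  proof -
    obtain x where x: "x \<in> johnson_vertices n w" "c x = i" using colour_exists[OF i(2)] .
    have "h (c (exchange x m)) = 0" if "m \<in> moves n x" for m
      using colour_step'[OF x(1) that] x(2) i colour_less[OF exchange_vertex[OF x(1) that]]
      by (intro supp) auto
    then show ?thesis using quotient_shift[OF x(1), of \<theta> h] x(2) supp i by simp
  qed
qed

lemma design_count:
  assumes "\<And>p. p \<in> {1..n} \<Longrightarrow> card {x \<in> johnson_vertices n w. p \<in> x \<and> c x = 0} = l"
  shows "n * l = w * card {x \<in> johnson_vertices n w. c x = 0}"
proof -
  let ?C = "{x \<in> johnson_vertices n w. c x = 0}"
  have "n * l = (\<Sum>p\<in>{1..n}. card {x \<in> ?C. p \<in> x})"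
    using assms by (simp add: conj_commute conj_left_commute)
  also have "\<dots> = (\<Sum>p\<in>{1..n}. \<Sum>x\<in>?C. if p \<in> x then 1 else 0)"
    by (intro sum.cong refl) (simp add: sum.inter_filter[symmetric])
  also have "\<dots> = (\<Sum>x\<in>?C. card {p \<in> {1..n}. p \<in> x})"
    by (subst sum.swap) (simp add: sum.inter_filter[symmetric])
  also have "\<dots> = (\<Sum>x\<in>?C. w)"
  proof (rule sum.cong[OF refl])
    fix x assume "x \<in> ?C"
    then have "{p \<in> {1..n}. p \<in> x} = x" "card x = w" by (auto simp: johnson_vertices_def)
    then show "card {p \<in> {1..n}. p \<in> x} = w" by simp
  qed
  finally show ?thesis by simp
qed

text \<open>Shifting by the eigenvalues \<open>\<theta>\<^sub>0, \<theta>\<^sub>2, \<dots>, \<theta>\<^sub>k\<close> annihilates all sums over the supersets of a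
  \<open>k\<close>-set; the eigenvalue \<open>\<theta>\<^sub>1\<close> can be skipped because the code is a 1-design.\<close>

lemma null_weights:
  assumes "1 \<le> k" "k < w"
  shows "\<exists>h :: nat \<Rightarrow> int. h k > 0 \<and> (\<forall>i. k < i \<and> i < w \<longrightarrow> h i = 0) \<and>
    (\<forall>T. T \<subseteq> {1..n} \<and> card T = k \<longrightarrow> (\<Sum>x | x \<in> johnson_vertices n w \<and> T \<subseteq> x. h (c x)) = 0)"
  using assms
proof (induction k rule: dec_induct)
  case base
  let ?V = "johnson_vertices n w"
  let ?h = "\<lambda>i::nat. if i = 0 then 1 else 0 :: int"
  let ?\<theta> = "int w * (int n - int w)"
  obtain l where l: "\<And>p. p \<in> {1..n} \<Longrightarrow> card {x \<in> ?V. p \<in> x \<and> c x = 0} = l"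
    using design by blast
  have "(\<Sum>x | x \<in> ?V \<and> T \<subseteq> x. quotient_shift ?\<theta> ?h (c x)) = 0" if T: "T \<subseteq> {1..n}" "card T = 1" for T
  proof -
    obtain p where p: "T = {p}" using T(2) by (rule card_1_singletonE)
    have "(\<Sum>x | x \<in> ?V \<and> {p} \<subseteq> x. ?h (c x)) = int (card {x \<in> {x \<in> ?V. {p} \<subseteq> x}. c x = 0})"
      by (subst sum.inter_filter[symmetric]) auto
    also have "{x \<in> {x \<in> ?V. {p} \<subseteq> x}. c x = 0} = {x \<in> ?V. p \<in> x \<and> c x = 0}" by auto
    finally have s1: "(\<Sum>x | x \<in> ?V \<and> {p} \<subseteq> x. ?h (c x)) = int l" using l[of p] T p by simp
    have s0: "(\<Sum>x | x \<in> ?V \<and> {} \<subseteq> x. ?h (c x)) = int (card {x \<in> ?V. c x = 0})"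
      by (simp add: sum.inter_filter[symmetric])
    have "int n * int l = int w * int (card {x \<in> ?V. c x = 0})"
      using design_count[OF l] by (metis of_nat_mult)
    moreover have "(\<Sum>x | x \<in> ?V \<and> {p} \<subseteq> x. quotient_shift ?\<theta> ?h (c x))
      = (\<Sum>x | x \<in> ?V \<and> {p} \<subseteq> x. \<Sum>m\<in>moves n x. ?h (c (exchange x m)))
        - ?\<theta> * (\<Sum>x | x \<in> ?V \<and> {p} \<subseteq> x. ?h (c x))"
      by (rule sum_quotient_shift) auto
    moreover have "(\<Sum>x | x \<in> ?V \<and> {p} \<subseteq> x. \<Sum>m\<in>moves n x. ?h (c (exchange x m)))
      = ((int w - 1) * (int n - int w - 1) - 1) * int l + int w * int (card {x \<in> ?V. c x = 0})"
      using sum_superset_adjacency[of "{p}" n 1, where f = "\<lambda>x. ?h (c x)" and w = w] T p s1 s0 by simp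
    ultimately have "(\<Sum>x | x \<in> ?V \<and> {p} \<subseteq> x. quotient_shift ?\<theta> ?h (c x)) = 
       ((int w - 1) * (int n - int w - 1) - 1) * int l + int n * int l - ?\<theta> * int l"
      using s1 by simp
    then show ?thesis using p by (simp add: algebra_simps)
  qed
  then show ?case
    using quotient_shift_support[where k = 0 and h = ?h and \<theta> = ?\<theta>] base by (intro exI[of _ "quotient_shift ?\<theta> ?h"]) auto
next
  case (step k)
  let ?V = "johnson_vertices n w"
  obtain h :: "nat \<Rightarrow> int" where h: "h k > 0" "\<And>i. k < i \<Longrightarrow> i < w \<Longrightarrow> h i = 0"
    "\<And>T. T \<subseteq> {1..n} \<Longrightarrow> card T = k \<Longrightarrow> (\<Sum>x | x \<in> ?V \<and> T \<subseteq> x. h (c x)) = 0"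
    using step by auto
  let ?\<theta> = "(int w - int (Suc k)) * (int n - int w - int (Suc k)) - int (Suc k)"
  have "(\<Sum>x | x \<in> ?V \<and> T \<subseteq> x. quotient_shift ?\<theta> h (c x)) = 0" if T: "T \<subseteq> {1..n}" "card T = Suc k" for T
  proof -
    have "finite T" using T(1) finite_subset by blast
    then have "(\<Sum>x | x \<in> ?V \<and> T - {s} \<subseteq> x. h (c x)) = 0" if "s \<in> T" for s
      using that T by (intro h(3)) auto
    then have "(\<Sum>x | x \<in> ?V \<and> T \<subseteq> x. \<Sum>m\<in>moves n x. h (c (exchange x m)))
      = ?\<theta> * (\<Sum>x | x \<in> ?V \<and> T \<subseteq> x. h (c x))"
      using sum_superset_adjacency[OF T, where f = "\<lambda>x. h (c x)" and w = w] by simp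
    moreover have "(\<Sum>x | x \<in> ?V \<and> T \<subseteq> x. quotient_shift ?\<theta> h (c x))
      = (\<Sum>x | x \<in> ?V \<and> T \<subseteq> x. \<Sum>m\<in>moves n x. h (c (exchange x m)))
        - ?\<theta> * (\<Sum>x | x \<in> ?V \<and> T \<subseteq> x. h (c x))"
      by (rule sum_quotient_shift) auto
    ultimately show ?thesis by simp
  qed
  then show ?case
    using quotient_shift_support[where k = k and h = h and \<theta> = ?\<theta>] h(1,2) step
    by (intro exI[of _ "quotient_shift ?\<theta> h"]) auto
qed

end

section \<open>The induced colouring of smaller sets\<close>

lemma insert_vertex:
  assumes "a \<in> johnson_vertices n (w - 1)" "v \<in> {1..n} - a" "w \<ge> 1"
  shows "insert v a \<in> johnson_vertices n w"
  using assms finite_vertex[OF assms(1)] by (auto simp: johnson_vertices_def)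

lemma remove_vertex:
  assumes "x \<in> johnson_vertices n w" "u \<in> x"
  shows "x - {u} \<in> johnson_vertices n (w - 1)"
  using assms finite_vertex[OF assms(1)] by (auto simp: johnson_vertices_def)

lemma sum_supersets:
  fixes f :: "nat set \<Rightarrow> int"
  assumes a: "a \<in> johnson_vertices n (w - 1)" and w: "w \<ge> 1"
  shows "(\<Sum>x | x \<in> johnson_vertices n w \<and> a \<subseteq> x. f x) = (\<Sum>v\<in>{1..n} - a. f (insert v a))"
proof -
  have "{x. x \<in> johnson_vertices n w \<and> a \<subseteq> x} = (\<lambda>v. insert v a) ` ({1..n} - a)"
  proof (intro equalityI subsetI)
    fix x assume "x \<in> {x. x \<in> johnson_vertices n w \<and> a \<subseteq> x}"
    then have x: "x \<in> johnson_vertices n w" "a \<subseteq> x" by auto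
    have "card (x - a) = 1"
      using x a w finite_vertex[OF a] by (simp add: card_Diff_subset johnson_vertices_def)
    then obtain v where "x - a = {v}" by (rule card_1_singletonE)
    then have "x = insert v a" "v \<in> {1..n} - a" using x by (auto simp: johnson_vertices_def)
    then show "x \<in> (\<lambda>v. insert v a) ` ({1..n} - a)" by blast
  next
    fix x assume "x \<in> (\<lambda>v. insert v a) ` ({1..n} - a)"
    then show "x \<in> {x. x \<in> johnson_vertices n w \<and> a \<subseteq> x}"
      using insert_vertex[OF a _ w] by auto
  qed
  moreover have "inj_on (\<lambda>v. insert v a) ({1..n} - a)" by (rule inj_onI) auto
  ultimately show ?thesis by (simp add: sum.reindex)
qed

lemma sum_two_values:
  fixes g :: "nat \<Rightarrow> 'a::comm_semiring_1"
  assumes "finite S" "\<And>v. v \<in> S \<Longrightarrow> f v = i \<or> f v = Suc i"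
  shows "(\<Sum>v\<in>S. g (f v)) = of_nat (card {v \<in> S. f v = i}) * g i
    + of_nat (card {v \<in> S. f v = Suc i}) * g (Suc i)"
proof -
  have "(\<Sum>v\<in>S. g (f v)) = (\<Sum>v\<in>S. (if f v = i then g i else 0) + (if f v = Suc i then g (Suc i) else 0))"
    using assms(2) by (intro sum.cong) auto
  then show ?thesis by (simp add: sum.distrib sum.inter_filter[symmetric] assms(1))
qed

lemma factor_through:
  assumes "\<And>x y. x \<in> A \<Longrightarrow> y \<in> A \<Longrightarrow> d x = d y \<Longrightarrow> F x = F y"
  shows "\<exists>K. \<forall>x \<in> A. F x = K (d x)"
proof (intro exI ballI)
  fix x assume x: "x \<in> A"
  have "(SOME y. y \<in> A \<and> d y = d x) \<in> A \<and> d (SOME y. y \<in> A \<and> d y = d x) = d x"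
    using x by (intro someI[of "\<lambda>y. y \<in> A \<and> d y = d x" x]) simp
  then show "F x = (\<lambda>i. F (SOME y. y \<in> A \<and> d y = i)) (d x)" using assms[OF x] by simp
qed

locale chain_colouring_ge2 = chain_colouring +
  assumes w_ge2: "2 \<le> w"
begin

lemma clique_step:
  assumes a: "a \<in> johnson_vertices n (w - 1)" and u: "u \<in> {1..n} - a" and v: "v \<in> {1..n} - a"
  shows "c (insert v a) \<le> c (insert u a) + 1"
proof (cases "u = v")
  case False
  have "exchange (insert u a) (u, v) = insert v a" "(u, v) \<in> moves n (insert u a)"
    using u v False by (auto simp: exchange_def moves_def)
  then show ?thesis using colour_step[OF insert_vertex[OF a u]] w_ge2 by fastforce
qed simp

lemma weights:
  "\<exists>h :: nat \<Rightarrow> int. (\<forall>i < w. h i \<noteq> 0) \<and>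
    (\<forall>a \<in> johnson_vertices n (w - 1). (\<Sum>v\<in>{1..n} - a. h (c (insert v a))) = 0)"
proof -
  have "1 \<le> w - 1" "w - 1 < w" using w_ge2 by auto
  from null_weights[OF this] obtain h :: "nat \<Rightarrow> int" where h: "h (w - 1) > 0"
    "\<And>T. T \<subseteq> {1..n} \<Longrightarrow> card T = w - 1 \<Longrightarrow> (\<Sum>x | x \<in> johnson_vertices n w \<and> T \<subseteq> x. h (c x)) = 0"
    by blast
  have sum0: "(\<Sum>v\<in>{1..n} - a. h (c (insert v a))) = 0" if a: "a \<in> johnson_vertices n (w - 1)" for a
  proof -
    have "(\<Sum>x | x \<in> johnson_vertices n w \<and> a \<subseteq> x. h (c x)) = 0"
      using a by (intro h(2)) (auto simp: johnson_vertices_def)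
    then show ?thesis using sum_supersets[OF a, of "\<lambda>x. h (c x)"] w_ge2 by simp
  qed
  have nonzero: "h i \<noteq> 0" if "i \<le> w - 1" for i
    using that
  proof (induction i rule: inc_induct)
    case base
    then show ?case using h(1) by simp
  next
    case (step i)
    have "Suc i < w" using step by simp
    then obtain x where x: "x \<in> johnson_vertices n w" "c x = Suc i" using colour_exists by blast
    then obtain m where m: "m \<in> moves n x" "c (exchange x m) = i" using colour_descent[of x] by auto
    define a where "a = x - {fst m}"
    have a: "a \<in> johnson_vertices n (w - 1)"
      unfolding a_def using remove_vertex[OF x(1)] m(1) by (auto simp: moves_def)
    have ms: "fst m \<in> {1..n} - a" "snd m \<in> {1..n} - a" "insert (fst m) a = x" "insert (snd m) a = exchange x m"
      using m(1) x(1) by (auto simp: a_def moves_def exchange_def johnson_vertices_def)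
    have two: "c (insert v a) = i \<or> c (insert v a) = Suc i" if "v \<in> {1..n} - a" for v
      using clique_step[OF a that ms(1)] clique_step[OF a ms(2) that] ms(3,4) x(2) m(2) by auto
    have mem: "fst m \<in> {v \<in> {1..n} - a. c (insert v a) = Suc i}" using ms x by simp
    define k where "k = int (card {v \<in> {1..n} - a. c (insert v a) = Suc i})"
    have "card {v \<in> {1..n} - a. c (insert v a) = Suc i} > 0"
      by (rule card_pos[OF _ mem]) simp
    then have "k > 0" unfolding k_def by (simp only: of_nat_0_less_iff)
    moreover have "int (card {v \<in> {1..n} - a. c (insert v a) = i}) * h i + k * h (Suc i) = 0"
      using sum_two_values[of "{1..n} - a" "\<lambda>v. c (insert v a)" i h] two sum0[OF a]
      by (simp add: k_def)
    ultimately show ?case using step.IH by auto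
  qed
  have "\<forall>i < w. h i \<noteq> 0" using nonzero by simp
  then show ?thesis using sum0 by blast
qed

definition down :: "nat set \<Rightarrow> nat" where
  "down a = Min ((\<lambda>v. c (insert v a)) ` ({1..n} - a))"

lemma w_le_n: "w \<le> n"
  using top_colour johnson_vertices_leD by blast

lemma complement_nonempty:
  assumes "a \<in> johnson_vertices n (w - 1)"
  shows "{1..n} - a \<noteq> {}"
proof
  assume "{1..n} - a = {}"
  then have "n \<le> w - 1" using assms card_mono[of a "{1..n}"] finite_vertex[OF assms]
    by (auto simp: johnson_vertices_def)
  then show False using w_le_n w_ge2 by simp
qed

lemma down_attained:
  assumes "a \<in> johnson_vertices n (w - 1)"
  obtains v where "v \<in> {1..n} - a" "c (insert v a) = down a"
proof -
  have "down a \<in> (\<lambda>v. c (insert v a)) ` ({1..n} - a)"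
    unfolding down_def using complement_nonempty[OF assms] by (intro Min_in) auto
  then show ?thesis using that by force
qed

lemma down_cases:
  assumes a: "a \<in> johnson_vertices n (w - 1)" and v: "v \<in> {1..n} - a"
  shows "c (insert v a) = down a \<or> c (insert v a) = Suc (down a)"
proof -
  obtain u where u: "u \<in> {1..n} - a" "c (insert u a) = down a" using down_attained[OF a] .
  have "down a \<le> c (insert v a)" unfolding down_def using v by (intro Min_le) auto
  then show ?thesis using clique_step[OF a u(1) v] u(2) by auto
qed

text \<open>By \<open>weights\<close>, a weighted count of the two colours in a clique vanishes, so both colours occur.\<close>

lemma down_attained_Suc:
  assumes a: "a \<in> johnson_vertices n (w - 1)"
  obtains v where "v \<in> {1..n} - a" "c (insert v a) = Suc (down a)"
proof -
  obtain h :: "nat \<Rightarrow> int" where h: "\<And>i. i < w \<Longrightarrow> h i \<noteq> 0"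
    "\<And>a. a \<in> johnson_vertices n (w - 1) \<Longrightarrow> (\<Sum>v\<in>{1..n} - a. h (c (insert v a))) = 0"
    using weights by blast
  have "\<exists>v. v \<in> {1..n} - a \<and> c (insert v a) = Suc (down a)"
  proof (rule ccontr)
    assume "\<not> ?thesis"
    then have "c (insert v a) = down a" if "v \<in> {1..n} - a" for v
      using down_cases[OF a that] that by blast
    then have "int (card ({1..n} - a)) * h (down a) = 0" using h(2)[OF a] by simp
    moreover have "card ({1..n} - a) \<noteq> 0" using complement_nonempty[OF a] by (simp only: card_0_eq finite_Diff finite_atLeastAtMost simp_thms)
    moreover have "down a < w"
      using down_attained[OF a] colour_less insert_vertex[OF a] w_ge2 by (metis le_trans one_le_numeral)
    ultimately show False using h(1) by simp
  qed
  then show ?thesis using that by blast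
qed

lemma down_less:
  assumes "a \<in> johnson_vertices n (w - 1)"
  shows "Suc (down a) < w"
proof -
  obtain v where "v \<in> {1..n} - a" "c (insert v a) = Suc (down a)" using down_attained_Suc[OF assms] .
  then show ?thesis using colour_less[OF insert_vertex[OF assms], of v] w_ge2 by simp
qed

lemma card_complement:
  assumes "a \<in> johnson_vertices n (w - 1)"
  shows "card {v \<in> {1..n} - a. c (insert v a) = down a}
    + card {v \<in> {1..n} - a. c (insert v a) = Suc (down a)} = n - (w - 1)"
proof -
  have "(\<Sum>v\<in>{1..n} - a. 1) = card {v \<in> {1..n} - a. c (insert v a) = down a}
    + card {v \<in> {1..n} - a. c (insert v a) = Suc (down a)}"
    using sum_two_values[of "{1..n} - a" "\<lambda>v. c (insert v a)" "down a" "\<lambda>_. 1 :: nat"]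
      down_cases[OF assms] by simp
  moreover have "card ({1..n} - a) = n - (w - 1)"
    using assms finite_vertex[OF assms] by (simp add: card_Diff_subset johnson_vertices_def)
  ultimately show ?thesis by simp
qed

lemma down_count:
  assumes a: "a \<in> johnson_vertices n (w - 1)" and b: "b \<in> johnson_vertices n (w - 1)"
    and ab: "down a = down b"
  shows "card {v \<in> {1..n} - a. c (insert v a) = down a} = card {v \<in> {1..n} - b. c (insert v b) = down b}"
proof -
  obtain h :: "nat \<Rightarrow> int" where h: "\<And>i. i < w \<Longrightarrow> h i \<noteq> 0"
    "\<And>a. a \<in> johnson_vertices n (w - 1) \<Longrightarrow> (\<Sum>v\<in>{1..n} - a. h (c (insert v a))) = 0"
    using weights by blast
  let ?N = "int (n - (w - 1))"
  let ?k = "\<lambda>a. int (card {v \<in> {1..n} - a. c (insert v a) = down a})"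
  have eq: "?k a * (h (down a) - h (Suc (down a))) = - ?N * h (Suc (down a))"
    if a: "a \<in> johnson_vertices n (w - 1)" for a
  proof -
    have "?k a * h (down a) + int (card {v \<in> {1..n} - a. c (insert v a) = Suc (down a)}) * h (Suc (down a)) = 0"
      using sum_two_values[of "{1..n} - a" "\<lambda>v. c (insert v a)" "down a" h] down_cases[OF a] h(2)[OF a] by simp
    moreover have "int (card {v \<in> {1..n} - a. c (insert v a) = Suc (down a)}) = ?N - ?k a"
      using card_complement[OF a] by linarith
    moreover have "k * x + l * y = 0 \<Longrightarrow> l = m - k \<Longrightarrow> k * (x - y) = - m * y" for k l m x y :: int
      by (simp add: algebra_simps)
    ultimately show ?thesis by blast
  qed
  have "?N \<noteq> 0" using w_le_n w_ge2 by simp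
  moreover have "h (Suc (down a)) \<noteq> 0" using h(1) down_less[OF a] by blast
  ultimately have "h (down a) - h (Suc (down a)) \<noteq> 0"
    using eq[OF a] by (metis mult_zero_right mult_eq_0_iff neg_equal_0_iff_equal)
  moreover have "?k a * (h (down a) - h (Suc (down a))) = ?k b * (h (down a) - h (Suc (down a)))"
    using eq[OF a] eq[OF b] ab by simp
  ultimately show ?thesis by simp
qed

lemma down_count_pos:
  assumes "a \<in> johnson_vertices n (w - 1)"
  shows "card {v \<in> {1..n} - a. c (insert v a) = down a} > 0"
proof -
  obtain v where "v \<in> {1..n} - a" "c (insert v a) = down a" using down_attained[OF assms] .
  then show ?thesis by (intro card_pos[of _ v]) auto
qed

lemma clique_sum:
  fixes g :: "nat \<Rightarrow> nat"
  assumes a: "a \<in> johnson_vertices n (w - 1)" and b: "b \<in> johnson_vertices n (w - 1)"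
    and ab: "down a = down b"
  shows "(\<Sum>v\<in>{1..n} - a. g (c (insert v a))) = (\<Sum>v\<in>{1..n} - b. g (c (insert v b)))"
proof -
  have "card {v \<in> {1..n} - a. c (insert v a) = Suc (down a)}
      = card {v \<in> {1..n} - b. c (insert v b) = Suc (down b)}"
    using card_complement[OF a] card_complement[OF b] down_count[OF a b ab] by linarith
  then show ?thesis
    using sum_two_values[of "{1..n} - a" "\<lambda>v. c (insert v a)" "down a" g] down_cases[OF a]
      sum_two_values[of "{1..n} - b" "\<lambda>v. c (insert v b)" "down b" g] down_cases[OF b]
      down_count[OF a b ab] ab by simp
qed

lemma colour_cases:
  assumes "x \<in> johnson_vertices n w" "u \<in> x"
  shows "c x = down (x - {u}) \<or> c x = Suc (down (x - {u}))"
proof -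
  have "u \<in> {1..n} - (x - {u})" "insert u (x - {u}) = x"
    using assms by (auto simp: johnson_vertices_def)
  then show ?thesis using down_cases[OF remove_vertex[OF assms], of u] by simp
qed

lemma sum_moves:
  fixes f :: "nat set \<Rightarrow> nat"
  shows "(\<Sum>m\<in>moves n x. f (exchange x m)) = (\<Sum>u\<in>x. \<Sum>v\<in>{1..n} - x. f (insert v (x - {u})))"
  unfolding moves_def by (simp add: sum.cartesian_product exchange_def split_def)

definition lower :: "nat set \<Rightarrow> nat \<Rightarrow> nat" where
  "lower x i = card {u \<in> x. down (x - {u}) = i}"

lemma lower_moves:
  assumes x: "x \<in> johnson_vertices n w" and cx: "c x = Suc i"
    and K: "\<And>a. a \<in> johnson_vertices n (w - 1) \<Longrightarrow> card {v \<in> {1..n} - a. c (insert v a) = down a} = K (down a)"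
  shows "card {m \<in> moves n x. c (exchange x m) = i} = lower x i * K i"
proof -
  have fx: "finite x" using x by (rule finite_vertex)
  have "card {m \<in> moves n x. c (exchange x m) = i} = (\<Sum>m\<in>moves n x. if c (exchange x m) = i then 1 else 0)"
    by (simp add: sum.inter_filter[symmetric] finite_moves[OF x])
  also have "\<dots> = (\<Sum>u\<in>x. card {v \<in> {1..n} - x. c (insert v (x - {u})) = i})"
    by (subst sum_moves[of "\<lambda>y. if c y = i then 1 else 0"]) (simp add: sum.inter_filter[symmetric])
  also have "\<dots> = (\<Sum>u\<in>x. if down (x - {u}) = i then K i else 0)"
  proof (rule sum.cong[OF refl])
    fix u assume u: "u \<in> x"
    have a: "x - {u} \<in> johnson_vertices n (w - 1)" using x u by (rule remove_vertex)
    have "u \<in> {1..n}" using u x by (auto simp: johnson_vertices_def)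
    then have xu: "{1..n} - (x - {u}) = insert u ({1..n} - x)" by blast
    have ux: "insert u (x - {u}) = x" using u by (rule insert_Diff)
    show "card {v \<in> {1..n} - x. c (insert v (x - {u})) = i} = (if down (x - {u}) = i then K i else 0)"
    proof (cases "down (x - {u}) = i")
      case True
      have "{v \<in> {1..n} - x. c (insert v (x - {u})) = i} = {v \<in> {1..n} - (x - {u}). c (insert v (x - {u})) = down (x - {u})}"
        unfolding True xu using ux cx by auto
      then show ?thesis using K[OF a] True by simp
    next
      case False
      then have "down (x - {u}) = Suc i" using colour_cases[OF x u] cx by auto
      then have "c (insert v (x - {u})) \<noteq> i" if "v \<in> {1..n} - x" for v
        using down_cases[OF a, of v] xu(1) that by auto
      then have "{v \<in> {1..n} - x. c (insert v (x - {u})) = i} = {}" by auto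
      then have "card {v \<in> {1..n} - x. c (insert v (x - {u})) = i} = 0" by (simp only: card.empty)
      then show ?thesis using False by simp
    qed
  qed
  also have "\<dots> = lower x i * K i"
    by (simp add: sum.inter_filter[symmetric] fx lower_def)
  finally show ?thesis .
qed

lemma lower_colour_0:
  assumes x: "x \<in> johnson_vertices n w" and "c x = 0"
  shows "lower x j = (if j = 0 then w else 0)"
proof -
  have "down (x - {u}) = 0" if "u \<in> x" for u using colour_cases[OF x that] assms by auto
  then have "{u \<in> x. down (x - {u}) = j} = (if j = 0 then x else {})" by auto
  then show ?thesis using x by (simp add: lower_def johnson_vertices_def)
qed

lemma lower_colour_Suc:
  assumes x: "x \<in> johnson_vertices n w" and cx: "c x = Suc i"
  shows "lower x j = (if j = i then lower x i else if j = Suc i then w - lower x i else 0)"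
proof -
  have d: "down (x - {u}) = i \<or> down (x - {u}) = Suc i" if "u \<in> x" for u
    using colour_cases[OF x that] cx by auto
  have "w = lower x i + lower x (Suc i)"
    using sum_two_values[of x "\<lambda>u. down (x - {u})" i "\<lambda>_. 1 :: nat"] d finite_vertex[OF x] x
    by (simp add: lower_def johnson_vertices_def)
  moreover have "lower x j = 0" if "j \<noteq> i" "j \<noteq> Suc i"
  proof -
    have "{u \<in> x. down (x - {u}) = j} = {}" using d that by auto
    then show ?thesis unfolding lower_def by (simp only: card.empty)
  qed
  ultimately show ?thesis by auto
qed

lemma down_count_factor:
  "\<exists>K. \<forall>a \<in> johnson_vertices n (w - 1).
    card {v \<in> {1..n} - a. c (insert v a) = down a} = K (down a) \<and> K (down a) > 0"
proof -
  have "\<exists>K. \<forall>a \<in> johnson_vertices n (w - 1).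
      card {v \<in> {1..n} - a. c (insert v a) = down a} = K (down a)"
    by (rule factor_through[where A = "johnson_vertices n (w - 1)" and d = down
        and F = "\<lambda>a. card {v \<in> {1..n} - a. c (insert v a) = down a}", OF down_count])
  then show ?thesis using down_count_pos by metis
qed

lemma lower_exists:
  assumes x: "x \<in> johnson_vertices n w" and cx: "c x = Suc i"
  obtains u where "u \<in> x" "down (x - {u}) = i"
proof -
  obtain m where m: "m \<in> moves n x" "c (exchange x m) = i"
    using colour_descent[OF x] cx by auto
  have u: "fst m \<in> x" using m(1) by (auto simp: moves_def)
  have "c (insert (snd m) (x - {fst m})) = i" using m(2) by (simp add: exchange_def)
  moreover have "snd m \<in> {1..n} - (x - {fst m})" using m(1) by (auto simp: moves_def)
  ultimately have "down (x - {fst m}) = i"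
    using down_cases[OF remove_vertex[OF x u], of "snd m"] colour_cases[OF x u] cx by auto
  then show ?thesis using that u by blast
qed

lemma lower_eq:
  assumes x: "x \<in> johnson_vertices n w" and y: "y \<in> johnson_vertices n w" and xy: "c x = c y"
  shows "lower x j = lower y j"
proof (cases "c x")
  case 0
  then show ?thesis using lower_colour_0[OF x] lower_colour_0[OF y] xy by simp
next
  case (Suc i)
  obtain K where K: "\<And>a. a \<in> johnson_vertices n (w - 1) \<Longrightarrow>
      card {v \<in> {1..n} - a. c (insert v a) = down a} = K (down a)"
    "\<And>a. a \<in> johnson_vertices n (w - 1) \<Longrightarrow> K (down a) > 0" using down_count_factor by blast
  have cy: "c y = Suc i" using Suc xy by simp
  obtain u where "u \<in> x" "down (x - {u}) = i" using lower_exists[OF x Suc] .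
  then have "K i > 0" using K(2) remove_vertex[OF x] by blast
  moreover have "lower x i * K i = lower y i * K i"
    using lower_moves[OF x Suc K(1)] lower_moves[OF y cy K(1)] equitable[OF x y xy, of i] by simp
  ultimately have "lower x i = lower y i" by simp
  then show ?thesis using lower_colour_Suc[OF x Suc, of j] lower_colour_Suc[OF y cy, of j] by simp
qed

lemma down_design:
  "\<exists>l. \<forall>p \<in> {1..n}. card {a \<in> johnson_vertices n (w - 1). p \<in> a \<and> down a = 0} = l"
proof -
  obtain l where l: "\<And>p. p \<in> {1..n} \<Longrightarrow> card {x \<in> johnson_vertices n w. p \<in> x \<and> c x = 0} = l"
    using design by blast
  obtain K where K: "\<And>a. a \<in> johnson_vertices n (w - 1) \<Longrightarrow>
      card {v \<in> {1..n} - a. c (insert v a) = down a} = K (down a)"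
    "\<And>a. a \<in> johnson_vertices n (w - 1) \<Longrightarrow> K (down a) > 0" using down_count_factor by blast
  have "card {a \<in> johnson_vertices n (w - 1). p \<in> a \<and> down a = 0} = l * (w - 1) div K 0"
    if p: "p \<in> {1..n}" for p
  proof -
    let ?A = "{a \<in> johnson_vertices n (w - 1). p \<in> a \<and> down a = 0}"
    let ?X = "{x \<in> johnson_vertices n w. p \<in> x \<and> c x = 0}"
    have "card ?A * K 0 = card (SIGMA a:?A. {v \<in> {1..n} - a. c (insert v a) = 0})"
    proof -
      have "card {v \<in> {1..n} - a. c (insert v a) = 0} = K 0" if "a \<in> ?A" for a
        using K(1)[of a] that by auto
      then show ?thesis by (subst card_SigmaI) auto
    qed
    also have "\<dots> = card (SIGMA x:?X. x - {p})"
    proof (rule bij_betw_same_card[of "\<lambda>(a, v). (insert v a, v)"],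
        rule bij_betw_byWitness[where f' = "\<lambda>(x, v). (x - {v}, v)"])
      show "(\<lambda>(a, v). (insert v a, v)) ` (SIGMA a:?A. {v \<in> {1..n} - a. c (insert v a) = 0})
          \<subseteq> (SIGMA x:?X. x - {p})"
        using insert_vertex[of _ n w] w_ge2 by auto
      show "(\<lambda>(x, v). (x - {v}, v)) ` (SIGMA x:?X. x - {p})
          \<subseteq> (SIGMA a:?A. {v \<in> {1..n} - a. c (insert v a) = 0})"
      proof (rule image_subsetI)
        fix z assume z: "z \<in> (SIGMA x:?X. x - {p})"
        obtain x v where xv: "z = (x, v)" by (cases z)
        then have a: "x \<in> johnson_vertices n w" "v \<in> x" "p \<in> x" "c x = 0" "v \<noteq> p" using z by auto
        have "insert v (x - {v}) = x" "v \<in> {1..n}" using a by (auto simp: johnson_vertices_def)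
        then show "(\<lambda>(x, v). (x - {v}, v)) z \<in> (SIGMA a:?A. {v \<in> {1..n} - a. c (insert v a) = 0})"
          using a xv remove_vertex[OF a(1,2)] colour_cases[OF a(1,2)] by auto
      qed
    qed auto
    also have "\<dots> = l * (w - 1)"
    proof -
      have "card (x - {p}) = w - 1" "finite x" if "x \<in> ?X" for x
        using that finite_vertex[of x n w] by (auto simp: johnson_vertices_def)
      then show ?thesis using l[OF p] by (subst card_SigmaI) auto
    qed
    finally have eq: "card ?A * K 0 = l * (w - 1)" .
    show ?thesis
    proof (cases "?A = {}")
      case True
      then have z: "card ?A = 0" by (simp only: card.empty)
      have "l * (w - 1) = 0" using eq unfolding z by simp
      then show ?thesis unfolding z by (simp only: div_0)
    next
      case False
      then obtain a where "a \<in> ?A" by blast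
      then have "K 0 > 0" using K(2)[of a] by auto
      then show ?thesis using eq by (metis div_mult_self_is_m)
    qed
  qed
  then show ?thesis by blast
qed

lemma down_moves:
  assumes a: "a \<in> johnson_vertices n (w - 1)"
  shows "card {m \<in> moves n a. down (exchange a m) = j}
    = (\<Sum>v\<in>{1..n} - a. lower (insert v a) j - (if down a = j then 1 else 0))"
proof -
  have fa: "finite a" using a by (rule finite_vertex)
  have "card {m \<in> moves n a. down (exchange a m) = j}
      = (\<Sum>m\<in>moves n a. if down (exchange a m) = j then 1 else 0)"
    by (simp add: sum.inter_filter[symmetric] finite_moves[OF a])
  also have "\<dots> = (\<Sum>u\<in>a. \<Sum>v\<in>{1..n} - a. if down (insert v (a - {u})) = j then 1 else 0)"
    by (rule sum_moves[of "\<lambda>y. if down y = j then 1 else 0"])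
  also have "\<dots> = (\<Sum>v\<in>{1..n} - a. card {u \<in> a. down (insert v (a - {u})) = j})"
    by (subst sum.swap) (simp add: sum.inter_filter[symmetric] fa)
  also have "\<dots> = (\<Sum>v\<in>{1..n} - a. lower (insert v a) j - (if down a = j then 1 else 0))"
  proof (rule sum.cong[OF refl])
    fix v assume v: "v \<in> {1..n} - a"
    let ?B = "{u \<in> a. down (insert v (a - {u})) = j}"
    have "{u \<in> insert v a. P u} = {u \<in> a. P u} \<union> (if P v then {v} else {})" for P by auto
    moreover have "{u \<in> a. down (insert v a - {u}) = j} = ?B"
    proof (rule Collect_cong)
      fix u
      have "insert v a - {u} = insert v (a - {u})" if "u \<in> a" using that v by auto
      then show "u \<in> a \<and> down (insert v a - {u}) = j \<longleftrightarrow> u \<in> a \<and> down (insert v (a - {u})) = j"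
        by (cases "u \<in> a") (simp_all only: simp_thms)
    qed
    moreover have "insert v a - {v} = a" using v by auto
    ultimately have "{u \<in> insert v a. down (insert v a - {u}) = j} = ?B \<union> (if down a = j then {v} else {})"
      by (simp only:)
    then show "card ?B = lower (insert v a) j - (if down a = j then 1 else 0)"
      using v fa by (simp add: lower_def)
  qed
  finally show ?thesis .
qed

lemma chain_colouring_down: "chain_colouring n (w - 1) down"
proof
  fix a assume a: "a \<in> johnson_vertices n (w - 1)"
  show "down a < w - 1" using down_less[OF a] by simp
next
  obtain x where x: "x \<in> johnson_vertices n w" "c x + 1 = w" using top_colour by blast
  then have "x \<noteq> {}" using w_ge2 by (auto simp: johnson_vertices_def)
  then obtain u where u: "u \<in> x" by blast
  have a: "x - {u} \<in> johnson_vertices n (w - 1)" using x(1) u by (rule remove_vertex)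
  then show "\<exists>a\<in>johnson_vertices n (w - 1). down a + 1 = w - 1"
    using colour_cases[OF x(1) u] down_less[OF a] x(2) by (intro bexI[of _ "x - {u}"]) auto
next
  fix a m assume a: "a \<in> johnson_vertices n (w - 1)" and m: "m \<in> moves n a"
  let ?x = "insert (snd m) a"
  have v: "snd m \<in> {1..n} - a" "fst m \<in> ?x" "?x - {fst m} = exchange a m"
    using m by (auto simp: moves_def exchange_def)
  have "?x \<in> johnson_vertices n w" using insert_vertex[OF a v(1)] w_ge2 by simp
  from colour_cases[OF this v(2)]
  have "c ?x = down (exchange a m) \<or> c ?x = Suc (down (exchange a m))" unfolding v(3) .
  then show "down (exchange a m) \<le> down a + 1" using down_cases[OF a v(1)] by linarith
next
  fix a assume a: "a \<in> johnson_vertices n (w - 1)" and pos: "down a > 0"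
  then obtain i where i: "down a = Suc i" by (cases "down a") auto
  obtain v where v: "v \<in> {1..n} - a" "c (insert v a) = Suc i" using down_attained[OF a] i by metis
  have x: "insert v a \<in> johnson_vertices n w" using insert_vertex[OF a v(1)] w_ge2 by simp
  obtain u where u: "u \<in> insert v a" "down (insert v a - {u}) = i" using lower_exists[OF x v(2)] .
  have av: "insert v a - {v} = a" using v(1) by auto
  have "insert v a - {u} \<noteq> a" using u(2) i by (metis n_not_Suc_n)
  then have "u \<noteq> v" using av by blast
  then have m: "(u, v) \<in> moves n a" and e: "exchange a (u, v) = insert v a - {u}"
    using u(1) v(1) by (auto simp: moves_def exchange_def)
  have "down (exchange a (u, v)) + 1 = down a" unfolding e using u(2) i by simp
  then show "\<exists>m\<in>moves n a. down (exchange a m) + 1 = down a" using m by (rule bexI)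
next
  fix a b j assume a: "a \<in> johnson_vertices n (w - 1)" and b: "b \<in> johnson_vertices n (w - 1)"
    and ab: "down a = down b"
  have "\<exists>L. \<forall>x \<in> johnson_vertices n w. lower x j = L (c x)"
    by (rule factor_through[where A = "johnson_vertices n w" and d = c and F = "\<lambda>x. lower x j", OF lower_eq])
  then obtain L where L: "\<And>x. x \<in> johnson_vertices n w \<Longrightarrow> lower x j = L (c x)" by blast
  have "card {m \<in> moves n a. down (exchange a m) = j}
      = (\<Sum>v\<in>{1..n} - a. L (c (insert v a)) - (if down a = j then 1 else 0))"
    if a: "a \<in> johnson_vertices n (w - 1)" for a
    unfolding down_moves[OF a] using L insert_vertex[OF a] w_ge2 by (intro sum.cong) auto
  from this[OF a] this[OF b]
  show "card {m \<in> moves n a. down (exchange a m) = j} = card {m \<in> moves n b. down (exchange b m) = j}"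
    using clique_sum[OF a b ab, of "\<lambda>i. L i - (if down a = j then 1 else 0)"] ab by simp
next
  show "\<exists>l. \<forall>p\<in>{1..n}. card {x \<in> johnson_vertices n (w - 1). p \<in> x \<and> down x = 0} = l"
    by (rule down_design)
qed

end

section \<open>Triples, quadruples and partitions into blocks\<close>

definition balanced_blocks :: "nat \<Rightarrow> (nat \<Rightarrow> nat set) \<Rightarrow> bool" where
  "balanced_blocks n \<beta> \<longleftrightarrow>
    (\<exists>k\<ge>3. \<forall>p\<in>{1..n}. card {q \<in> {1..n}. \<beta> q = \<beta> p} = k) \<and> 3 \<le> card (\<beta> ` {1..n})"

lemma card_image_eq_1_iff:
  assumes "x \<noteq> {}"
  shows "card (\<beta> ` x) = 1 \<longleftrightarrow> (\<exists>b. \<forall>p\<in>x. \<beta> p = b)"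
proof
  assume "card (\<beta> ` x) = 1"
  then obtain b where b: "\<beta> ` x = {b}" by (rule card_1_singletonE)
  have "\<beta> p = b" if "p \<in> x" for p using imageI[OF that, of \<beta>] unfolding b by simp
  then show "\<exists>b. \<forall>p\<in>x. \<beta> p = b" by blast
next
  assume "\<exists>b. \<forall>p\<in>x. \<beta> p = b"
  then obtain b where "\<forall>p\<in>x. \<beta> p = b" by blast
  then have "\<beta> ` x = {b}" using assms by auto
  then show "card (\<beta> ` x) = 1" by simp
qed

lemma type_GP2_of_blocks:
  assumes "balanced_blocks n \<beta>"
  shows "type_GP2 n {x \<in> johnson_vertices n 3. card (\<beta> ` x) = 1}"
proof -
  obtain k where k: "k \<ge> 3" "\<And>p. p \<in> {1..n} \<Longrightarrow> card {q \<in> {1..n}. \<beta> q = \<beta> p} = k"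
    and 3: "3 \<le> card (\<beta> ` {1..n})"
    using assms by (auto simp: balanced_blocks_def)
  let ?F = "\<lambda>b. {q \<in> {1..n}. \<beta> q = b}"
  let ?P = "?F ` \<beta> ` {1..n}"
  have part: "partition_on {1..n} ?P" by (rule partition_onI) (auto simp: disjnt_def)
  have "inj_on ?F (\<beta> ` {1..n})"
  proof (rule inj_onI)
    fix b b' assume b: "b \<in> \<beta> ` {1..n}" and e: "?F b = ?F b'"
    from b obtain p where "p \<in> ?F b" by blast
    moreover from this have "p \<in> ?F b'" unfolding e .
    ultimately show "b = b'" by simp
  qed
  then have "card ?P = card (\<beta> ` {1..n})" by (rule card_image)
  moreover have "card Y = k" if "Y \<in> ?P" for Y using that k(2) by force
  ultimately have eq: "equipartition n (card (\<beta> ` {1..n})) k ?P"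
    using part by (simp add: equipartition_def)
  have "x \<in> johnson_vertices n 3 \<and> card (\<beta> ` x) = 1 \<longleftrightarrow> card x = 3 \<and> (\<exists>Y \<in> ?P. x \<subseteq> Y)" for x
  proof (cases "card x = 3")
    case True
    then obtain p where p: "p \<in> x" by fastforce
    then have ne: "x \<noteq> {}" by blast
    have "x \<subseteq> {1..n} \<and> (\<exists>b. \<forall>p\<in>x. \<beta> p = b) \<longleftrightarrow> (\<exists>Y \<in> ?P. x \<subseteq> Y)"
    proof
      assume a: "x \<subseteq> {1..n} \<and> (\<exists>b. \<forall>p\<in>x. \<beta> p = b)"
      then have "x \<subseteq> ?F (\<beta> p)" "p \<in> {1..n}" using p by auto
      then show "\<exists>Y \<in> ?P. x \<subseteq> Y" by blast
    qed blast
    then show ?thesis unfolding card_image_eq_1_iff[OF ne] johnson_vertices_def mem_Collect_eq using True by argo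
  qed (simp add: johnson_vertices_def)
  then have "{x \<in> johnson_vertices n 3. card (\<beta> ` x) = 1} = {x. card x = 3 \<and> (\<exists>Y \<in> ?P. x \<subseteq> Y)}"
    by (rule Collect_cong)
  then show ?thesis using eq k(1) 3 unfolding type_GP2_def by blast
qed

lemma blocks_of_type_GP2:
  assumes "type_GP2 n C"
  obtains \<beta> where "balanced_blocks n \<beta>" "C = {x \<in> johnson_vertices n 3. card (\<beta> ` x) = 1}"
proof -
  obtain q k P where q: "q \<ge> 3" "k \<ge> 3" and P: "partition_on {1..n} P" "card P = q" "\<And>Y. Y \<in> P \<Longrightarrow> card Y = k"
    and C: "C = {x. card x = 3 \<and> (\<exists>Y\<in>P. x \<subseteq> Y)}"
    using assms by (auto simp: type_GP2_def equipartition_def)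
  define \<beta> where "\<beta> p = (THE Y. Y \<in> P \<and> p \<in> Y)" for p
  have \<beta>: "\<beta> p = Y" if "Y \<in> P" "p \<in> Y" for p Y
    unfolding \<beta>_def
    using that partition_onD2[OF P(1)] by (intro the_equality) (auto simp: disjoint_def)
  have sub: "Y \<subseteq> {1..n}" if "Y \<in> P" for Y using partition_onD1[OF P(1)] that by blast
  have ex: "\<exists>Y \<in> P. p \<in> Y" if "p \<in> {1..n}" for p using partition_onD1[OF P(1)] that by blast
  have im: "\<beta> ` {1..n} = P"
  proof
    show "\<beta> ` {1..n} \<subseteq> P" using ex \<beta> by fastforce
    show "P \<subseteq> \<beta> ` {1..n}"
    proof
      fix Y assume Y: "Y \<in> P"
      then have "Y \<noteq> {}" using partition_onD3[OF P(1)] by metis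
      then obtain p where "p \<in> Y" by blast
      then show "Y \<in> \<beta> ` {1..n}" using \<beta>[OF Y] sub[OF Y] by blast
    qed
  qed
  have "card {r \<in> {1..n}. \<beta> r = \<beta> p} = k" if p: "p \<in> {1..n}" for p
  proof -
    obtain Y where Y: "Y \<in> P" "p \<in> Y" using ex p by blast
    have "{r \<in> {1..n}. \<beta> r = Y} = Y" using \<beta> Y sub ex by blast
    then show ?thesis using \<beta>[OF Y] P(3)[OF Y(1)] by simp
  qed
  then have bal: "balanced_blocks n \<beta>" using q P(2) im by (auto simp: balanced_blocks_def)
  have "card x = 3 \<and> (\<exists>Y\<in>P. x \<subseteq> Y) \<longleftrightarrow> x \<in> johnson_vertices n 3 \<and> card (\<beta> ` x) = 1" for x
  proof (cases "card x = 3")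
    case True
    then obtain p where p: "p \<in> x" by fastforce
    then have ne: "x \<noteq> {}" by blast
    have "(\<exists>Y \<in> P. x \<subseteq> Y) \<longleftrightarrow> x \<subseteq> {1..n} \<and> (\<exists>b. \<forall>p\<in>x. \<beta> p = b)"
    proof
      assume "\<exists>Y \<in> P. x \<subseteq> Y"
      then obtain Y where Y: "Y \<in> P" "x \<subseteq> Y" by blast
      then have "\<forall>p\<in>x. \<beta> p = Y" using \<beta> by blast
      then show "x \<subseteq> {1..n} \<and> (\<exists>b. \<forall>p\<in>x. \<beta> p = b)" using sub Y by blast
    next
      assume a: "x \<subseteq> {1..n} \<and> (\<exists>b. \<forall>p\<in>x. \<beta> p = b)"
      have "r \<in> \<beta> p" if r: "r \<in> x" for r
      proof -
        obtain Y where "Y \<in> P" "r \<in> Y" using ex a r by blast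
        moreover from this have "\<beta> r = Y" using \<beta> by blast
        moreover have "\<beta> r = \<beta> p" using a r p by metis
        ultimately show ?thesis by simp
      qed
      moreover have "\<beta> p \<in> P" using im a p by blast
      ultimately show "\<exists>Y \<in> P. x \<subseteq> Y" by blast
    qed
    then show ?thesis unfolding card_image_eq_1_iff[OF ne] johnson_vertices_def mem_Collect_eq using True by argo
  qed (simp add: johnson_vertices_def)
  then have "C = {x \<in> johnson_vertices n 3. card (\<beta> ` x) = 1}" unfolding C by (rule Collect_cong)
  then show ?thesis using that bal by blast
qed

lemma card_ge_3E:
  assumes "3 \<le> card A"
  obtains a b d where "a \<in> A" "b \<in> A" "d \<in> A" "a \<noteq> b" "a \<noteq> d" "b \<noteq> d"
proof -
  obtain S where "S \<subseteq> A" "card S = 3" using assms obtain_subset_with_card_n by metis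
  then show ?thesis using that by (auto simp: card_3_iff)
qed

lemma johnson_vertices_3E:
  assumes "x \<in> johnson_vertices n 3"
  obtains p q r where "x = {p, q, r}" "p \<noteq> q" "p \<noteq> r" "q \<noteq> r" "p \<in> {1..n}" "q \<in> {1..n}" "r \<in> {1..n}"
  using assms that by (auto simp: johnson_vertices_def card_3_iff)

lemma johnson_vertices_3I:
  "p \<in> {1..n} \<Longrightarrow> q \<in> {1..n} \<Longrightarrow> r \<in> {1..n} \<Longrightarrow> p \<noteq> q \<Longrightarrow> p \<noteq> r \<Longrightarrow> q \<noteq> r \<Longrightarrow>
    {p, q, r} \<in> johnson_vertices n 3"
  by (auto simp: johnson_vertices_def)

lemma card_image_triple:
  "card (\<beta> ` {p, q, r}) = (if \<beta> p = \<beta> q \<and> \<beta> q = \<beta> r then 1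
    else if \<beta> p \<noteq> \<beta> q \<and> \<beta> q \<noteq> \<beta> r \<and> \<beta> p \<noteq> \<beta> r then 3 else 2)"
  by (auto simp: card_insert_if)

lemma blocks_of_cluster_graph:
  fixes e :: "nat \<Rightarrow> nat \<Rightarrow> bool"
  assumes sym: "\<And>p q. e p q \<Longrightarrow> e q p"
    and trans: "\<And>p q r. p \<in> {1..n} \<Longrightarrow> q \<in> {1..n} \<Longrightarrow> r \<in> {1..n} \<Longrightarrow>
      p \<noteq> q \<Longrightarrow> p \<noteq> r \<Longrightarrow> q \<noteq> r \<Longrightarrow> e p q \<Longrightarrow> e q r \<Longrightarrow> e p r"
    and regular: "\<And>p. p \<in> {1..n} \<Longrightarrow> card {q \<in> {1..n} - {p}. e p q} = l"
    and triangle: "\<exists>p q r. {p, q, r} \<in> johnson_vertices n 3 \<and> p \<noteq> q \<and> p \<noteq> r \<and> q \<noteq> r \<and> e p q \<and> e p r \<and> e q r"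
    and coclique: "\<exists>p q r. {p, q, r} \<in> johnson_vertices n 3 \<and> p \<noteq> q \<and> p \<noteq> r \<and> q \<noteq> r \<and> \<not> e p q \<and> \<not> e p r \<and> \<not> e q r"
  shows "\<exists>\<beta>. balanced_blocks n \<beta> \<and> (\<forall>p\<in>{1..n}. \<forall>q\<in>{1..n}. p \<noteq> q \<longrightarrow> (\<beta> p = \<beta> q \<longleftrightarrow> e p q))"
proof -
  define \<beta> where "\<beta> p = {q \<in> {1..n}. q = p \<or> e p q}" for p
  have mem: "r \<in> \<beta> p \<longleftrightarrow> r \<in> {1..n} \<and> (r = p \<or> e p r)" for p r by (simp add: \<beta>_def)
  have sub: "\<beta> p \<subseteq> \<beta> q" if "p \<in> {1..n}" "q \<in> {1..n}" "p \<noteq> q" "e p q" for p q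
  proof
    fix r assume "r \<in> \<beta> p"
    then have r: "r \<in> {1..n}" "r = p \<or> e p r" unfolding mem by blast+
    have "r = q \<or> e q r"
    proof (cases "r = p \<or> r = q")
      case False
      then have "e q r" using r trans[of q p r] sym[OF that(4)] that(1-3) by metis
      then show ?thesis ..
    qed (use sym[OF that(4)] in blast)
    then show "r \<in> \<beta> q" unfolding mem using r(1) by blast
  qed
  have eq: "\<beta> p = \<beta> q \<longleftrightarrow> e p q" if pq: "p \<in> {1..n}" "q \<in> {1..n}" "p \<noteq> q" for p q
  proof
    assume "\<beta> p = \<beta> q"
    moreover have "q \<in> \<beta> q" unfolding mem using pq by blast
    ultimately have "q \<in> \<beta> p" by (simp only:)
    then show "e p q" unfolding mem using pq(3) by blast
  next
    assume e: "e p q"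
    show "\<beta> p = \<beta> q" using sub[OF pq e] sub[OF pq(2,1) not_sym[OF pq(3)] sym[OF e]] by (rule equalityI)
  qed
  have k: "card {q \<in> {1..n}. \<beta> q = \<beta> p} = Suc l" if p: "p \<in> {1..n}" for p
  proof -
    have "{q \<in> {1..n}. \<beta> q = \<beta> p} = insert p {q \<in> {1..n} - {p}. e p q}"
    proof (rule set_eqI)
      fix q
      show "q \<in> {q \<in> {1..n}. \<beta> q = \<beta> p} \<longleftrightarrow> q \<in> insert p {q \<in> {1..n} - {p}. e p q}"
        using eq[OF p, of q] p by (cases "q = p"; cases "q \<in> {1..n}") (simp_all add: eq_commute[of "\<beta> p"] del: atLeastAtMost_iff)
    qed
    then show ?thesis using regular[OF p] by simp
  qed
  obtain p q r where pqr: "{p, q, r} \<in> johnson_vertices n 3" "p \<noteq> q" "p \<noteq> r" "q \<noteq> r" "e p q" "e p r" "e q r"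
    using triangle by blast
  then have pX: "p \<in> {1..n}" and "{q, r} \<subseteq> {q \<in> {1..n} - {p}. e p q}" by (auto simp: johnson_vertices_def)
  then have "card {q, r} \<le> l"
    unfolding regular[OF pX, symmetric] by (intro card_mono) simp_all
  then have "3 \<le> Suc l" using pqr by simp
  moreover obtain p q r where pqr: "{p, q, r} \<in> johnson_vertices n 3" "p \<noteq> q" "p \<noteq> r" "q \<noteq> r" "\<not> e p q" "\<not> e p r" "\<not> e q r"
    using coclique by blast
  have "card (\<beta> ` {p, q, r}) \<le> card (\<beta> ` {1..n})"
    using pqr(1) by (intro card_mono image_mono) (auto simp: johnson_vertices_def)
  moreover have "card (\<beta> ` {p, q, r}) = 3"
    using pqr eq unfolding card_image_triple by (auto simp: johnson_vertices_def)
  ultimately have "balanced_blocks n \<beta>"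
    using k unfolding balanced_blocks_def by (intro conjI exI[of _ "Suc l"]) auto
  then show ?thesis using eq by blast
qed

definition edges_in :: "(nat \<Rightarrow> nat \<Rightarrow> bool) \<Rightarrow> nat \<Rightarrow> nat \<Rightarrow> nat \<Rightarrow> nat" where
  "edges_in e p q r = of_bool (e p q) + of_bool (e p r) + of_bool (e q r)"

lemma chain_colouring_3_blocks:
  assumes "chain_colouring n 3 c"
  shows "\<exists>\<beta> \<epsilon>. balanced_blocks n \<beta> \<and> \<epsilon> \<in> {0, 2} \<and> (\<forall>x \<in> johnson_vertices n 3.
    (c x = \<epsilon> \<longleftrightarrow> card (\<beta> ` x) = 1) \<and> (c x = 1 \<longleftrightarrow> card (\<beta> ` x) = 2))"
proof -
  interpret chain_colouring_ge2 n 3 c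
    using assms by (simp add: chain_colouring_ge2_def chain_colouring_ge2_axioms_def)
  let ?V = "johnson_vertices n 3"
  let ?e = "\<lambda>p q. down {p, q} = 0"
  have low: "lower {p, q, r} 0 = edges_in ?e p q r" if "p \<noteq> q" "p \<noteq> r" "q \<noteq> r" for p q r
  proof -
    have d: "{p, q, r} - {p} = {q, r}" "{p, q, r} - {q} = {p, r}" "{p, q, r} - {r} = {p, q}"
      using that by auto
    have "lower {p, q, r} 0 = (\<Sum>u\<in>{p, q, r}. if down ({p, q, r} - {u}) = 0 then 1 else 0)"
      unfolding lower_def by (simp add: sum.inter_filter[symmetric] del: sum.insert)
    also have "\<dots> = edges_in ?e p q r"
      using that by (simp add: d edges_in_def del: insert_Diff_single)
    finally show ?thesis .
  qed
  have low0: "lower x 0 = 3" if "x \<in> ?V" "c x = 0" for x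
    using lower_colour_0[OF that] by simp
  have low2: "lower x 0 = 0" if "x \<in> ?V" "c x = 2" for x
    using lower_colour_Suc[of x 1 0] that by (simp add: numeral_2_eq_2)
  have low1: "\<exists>\<mu>. 0 < \<mu> \<and> \<mu> < 3 \<and> (\<forall>x\<in>?V. c x = 1 \<longrightarrow> lower x 0 = \<mu>)"
  proof -
    obtain x where x: "x \<in> ?V" "c x = 2" using colour_exists[of 2] by auto
    then obtain u where u: "u \<in> x" "down (x - {u}) = 1" using lower_exists[of x 1] by auto
    have a: "x - {u} \<in> johnson_vertices n (3 - 1)" using remove_vertex[OF x(1) u(1)] .
    obtain v where v: "v \<in> {1..n} - (x - {u})" "c (insert v (x - {u})) = 1"
      using down_attained[OF a] u by metis
    define y where "y = insert v (x - {u})"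
    have y: "y \<in> ?V" "c y = 1" using insert_vertex[OF a v(1)] v(2) by (simp_all add: y_def)
    have fy: "finite y" "card y = 3" using finite_vertex[OF y(1)] y(1) by (simp_all add: johnson_vertices_def)
    have yv: "y - {v} = x - {u}" "v \<in> y" using v(1) by (auto simp: y_def)
    have "down (y - {v}) \<noteq> 0" unfolding yv(1) u(2) by simp
    then have "{w \<in> y. down (y - {w}) = 0} \<subseteq> y - {v}" by blast
    then have "lower y 0 \<le> card (y - {v})" unfolding lower_def using fy by (intro card_mono) auto
    then have "lower y 0 < 3" using fy yv(2) by simp
    moreover have "lower y 0 > 0"
    proof -
      obtain u' where u': "u' \<in> y" "down (y - {u'}) = 0" using lower_exists[OF y(1), of 0] y(2) by auto
      show ?thesis unfolding lower_def using u' fy(1) by (intro card_pos[of _ u']) auto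
    qed
    moreover have "lower z 0 = lower y 0" if "z \<in> ?V" "c z = 1" for z
      using lower_eq[OF that(1) y(1)] that y(2) by simp
    ultimately show ?thesis by blast
  qed
  obtain \<mu> where \<mu>: "0 < \<mu>" "\<mu> < 3" "\<And>x. x \<in> ?V \<Longrightarrow> c x = 1 \<Longrightarrow> lower x 0 = \<mu>"
    using low1 by blast
  have c012: "c x = 0 \<or> c x = 1 \<or> c x = 2" if "x \<in> ?V" for x
    using colour_less[OF that] by linarith
  have c0_iff: "c x = 0 \<longleftrightarrow> lower x 0 = 3" and c1_iff: "c x = 1 \<longleftrightarrow> lower x 0 = \<mu>"
    and c2_iff: "c x = 2 \<longleftrightarrow> lower x 0 = 0"
    if "x \<in> ?V" for x
    using c012[OF that] low0[OF that] \<mu>(3)[OF that] low2[OF that] \<mu>(1,2) by auto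
  have vals: "lower x 0 \<in> {0, \<mu>, 3}" if "x \<in> ?V" for x
    using c012[OF that] c0_iff[OF that] c1_iff[OF that] c2_iff[OF that] by auto
  obtain l where l: "\<And>p. p \<in> {1..n} \<Longrightarrow> card {a \<in> johnson_vertices n 2. p \<in> a \<and> down a = 0} = l"
    using down_design by auto
  have deg: "card {q \<in> {1..n} - {p}. ?e p q} = l" if p: "p \<in> {1..n}" for p
  proof -
    have "{a \<in> johnson_vertices n 2. p \<in> a \<and> down a = 0} = (\<lambda>q. {p, q}) ` {q \<in> {1..n} - {p}. ?e p q}"
    proof (intro equalityI subsetI)
      fix a assume a: "a \<in> {a \<in> johnson_vertices n 2. p \<in> a \<and> down a = 0}"
      then have "card (a - {p}) = 1" using finite_vertex[of a] by (auto simp: johnson_vertices_def)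
      then obtain q where q: "a - {p} = {q}" by (rule card_1_singletonE)
      then have "a = {p, q}" "q \<in> {1..n} - {p}" using a by (auto simp: johnson_vertices_def)
      then show "a \<in> (\<lambda>q. {p, q}) ` {q \<in> {1..n} - {p}. ?e p q}" using a by blast
    next
      fix a assume "a \<in> (\<lambda>q. {p, q}) ` {q \<in> {1..n} - {p}. ?e p q}"
      then obtain q where "a = {p, q}" "q \<in> {1..n} - {p}" "down a = 0" by blast
      then show "a \<in> {a \<in> johnson_vertices n 2. p \<in> a \<and> down a = 0}"
        using p by (simp add: johnson_vertices_def)
    qed
    moreover have "inj_on (\<lambda>q. {p, q}) {q \<in> {1..n} - {p}. ?e p q}"
      by (rule inj_onI) (auto simp: doubleton_eq_iff)
    ultimately show ?thesis using l[OF p] by (simp add: card_image)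
  qed
  have ex: "\<exists>p q r. {p, q, r} \<in> ?V \<and> p \<noteq> q \<and> p \<noteq> r \<and> q \<noteq> r \<and> edges_in ?e p q r = i"
    if i: "i = 0 \<or> i = 3" for i
  proof -
    have "(if i = 3 then 0 else 2) < (3 :: nat)" by simp
    then obtain x where x: "x \<in> ?V" "c x = (if i = 3 then 0 else 2)" using colour_exists by blast
    obtain p q r where pqr: "x = {p, q, r}" "p \<noteq> q" "p \<noteq> r" "q \<noteq> r" using johnson_vertices_3E[OF x(1)] by metis
    have "lower x 0 = i" using low0[OF x(1)] low2[OF x(1)] x(2) i by (auto split: if_splits)
    then show ?thesis using low pqr x(1) by metis
  qed
  obtain \<epsilon> :: nat where \<epsilon>: "\<epsilon> = (if \<mu> = 1 then 0 else 2)" by blast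
  define e where "e p q \<longleftrightarrow> ?e p q \<longleftrightarrow> \<mu> = 1" for p q
  have edges: "edges_in e p q r = (if \<mu> = 1 then edges_in ?e p q r else 3 - edges_in ?e p q r)" for p q r
    by (auto simp: edges_in_def e_def)
  have not2: "edges_in e p q r \<noteq> 2" if "{p, q, r} \<in> ?V" "p \<noteq> q" "p \<noteq> r" "q \<noteq> r" for p q r
  proof -
    have "edges_in ?e p q r \<in> {0, \<mu>, 3}" using vals[OF that(1)] low[OF that(2-)] by simp
    then show ?thesis using \<mu>(1,2) unfolding edges by auto
  qed
  have ex_e: "\<exists>p q r. {p, q, r} \<in> ?V \<and> p \<noteq> q \<and> p \<noteq> r \<and> q \<noteq> r \<and> edges_in e p q r = i"
    if i: "i = 0 \<or> i = 3" for i
  proof -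
    have "(if \<mu> = 1 then i else 3 - i) = 0 \<or> (if \<mu> = 1 then i else 3 - i) = 3" using i by auto
    from ex[OF this] obtain p q r where "{p, q, r} \<in> ?V" "p \<noteq> q" "p \<noteq> r" "q \<noteq> r"
      "edges_in ?e p q r = (if \<mu> = 1 then i else 3 - i)"
      by blast
    moreover from this have "edges_in e p q r = i" using i unfolding edges by auto
    ultimately show ?thesis by blast
  qed
  have "\<exists>\<beta>. balanced_blocks n \<beta> \<and> (\<forall>p\<in>{1..n}. \<forall>q\<in>{1..n}. p \<noteq> q \<longrightarrow> (\<beta> p = \<beta> q \<longleftrightarrow> e p q))"
  proof (rule blocks_of_cluster_graph)
    show "e q p" if "e p q" for p q using that by (simp add: e_def insert_commute)
    show "e p r" if "p \<in> {1..n}" "q \<in> {1..n}" "r \<in> {1..n}" "p \<noteq> q" "p \<noteq> r" "q \<noteq> r" "e p q" "e q r" for p q r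
      using not2[OF johnson_vertices_3I[OF that(1-6)] that(4-6)] that(7,8)
      by (cases "e p r") (simp_all add: edges_in_def)
    show "card {q \<in> {1..n} - {p}. e p q} = (if \<mu> = 1 then l else n - 1 - l)" if p: "p \<in> {1..n}" for p
    proof (cases "\<mu> = 1")
      case True
      then show ?thesis using deg[OF p] by (simp add: e_def)
    next
      case False
      then have "{q \<in> {1..n} - {p}. e p q} = ({1..n} - {p}) - {q \<in> {1..n} - {p}. ?e p q}"
        by (auto simp: e_def)
      moreover have "card (({1..n} - {p}) - {q \<in> {1..n} - {p}. ?e p q}) = card ({1..n} - {p}) - l"
        using deg[OF p] by (subst card_Diff_subset) auto
      ultimately show ?thesis using False p by simp
    qed
    have *: "edges_in e p q r = 3 \<longleftrightarrow> e p q \<and> e p r \<and> e q r"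
      "edges_in e p q r = 0 \<longleftrightarrow> \<not> e p q \<and> \<not> e p r \<and> \<not> e q r" for p q r
      by (auto simp: edges_in_def)
    show "\<exists>p q r. {p, q, r} \<in> ?V \<and> p \<noteq> q \<and> p \<noteq> r \<and> q \<noteq> r \<and> e p q \<and> e p r \<and> e q r"
      unfolding *(1)[symmetric] by (rule ex_e) simp
    show "\<exists>p q r. {p, q, r} \<in> ?V \<and> p \<noteq> q \<and> p \<noteq> r \<and> q \<noteq> r \<and> \<not> e p q \<and> \<not> e p r \<and> \<not> e q r"
      unfolding *(2)[symmetric] by (rule ex_e) simp
  qed
  then obtain \<beta> where \<beta>: "balanced_blocks n \<beta>"
    "\<And>p q. p \<in> {1..n} \<Longrightarrow> q \<in> {1..n} \<Longrightarrow> p \<noteq> q \<Longrightarrow> \<beta> p = \<beta> q \<longleftrightarrow> e p q"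
    by blast
  have "(c x = \<epsilon> \<longleftrightarrow> card (\<beta> ` x) = 1) \<and> (c x = 1 \<longleftrightarrow> card (\<beta> ` x) = 2)" if x: "x \<in> ?V" for x
  proof -
    obtain p q r where pqr: "x = {p, q, r}" "p \<noteq> q" "p \<noteq> r" "q \<noteq> r" "p \<in> {1..n}" "q \<in> {1..n}" "r \<in> {1..n}"
      using johnson_vertices_3E[OF x] .
    have b: "\<beta> p = \<beta> q \<longleftrightarrow> e p q" "\<beta> p = \<beta> r \<longleftrightarrow> e p r" "\<beta> q = \<beta> r \<longleftrightarrow> e q r"
      using \<beta>(2) pqr by auto
    have im: "card (\<beta> ` x) = (if edges_in e p q r = 3 then 1 else if edges_in e p q r = 0 then 3 else 2)"
      unfolding pqr(1) card_image_triple b[symmetric] edges_in_def by auto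
    have lx: "lower x 0 = edges_in ?e p q r" using low pqr by simp
    have e3: "edges_in ?e p q r \<le> 3" by (simp add: edges_in_def)
    have v: "edges_in ?e p q r \<in> {0, \<mu>, 3}" using vals[OF x] lx by simp
    have "c x = \<epsilon> \<longleftrightarrow> card (\<beta> ` x) = 1"
      using c0_iff[OF x] c2_iff[OF x] v \<mu>(1,2) unfolding im edges lx \<epsilon> by auto
    moreover have "c x = 1 \<longleftrightarrow> card (\<beta> ` x) = 2"
      using c1_iff[OF x] v \<mu>(1,2) unfolding im edges lx by auto
    ultimately show ?thesis by blast
  qed
  moreover have "\<epsilon> \<in> {0, 2}" using \<epsilon> by simp
  ultimately show ?thesis using \<beta>(1) by blast
qed

lemma card_filter_remove_4:
  assumes "p \<noteq> q" "p \<noteq> r" "p \<noteq> s" "q \<noteq> r" "q \<noteq> s" "r \<noteq> s"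
  shows "card {u \<in> {p, q, r, s}. Q ({p, q, r, s} - {u})}
    = of_bool (Q {q, r, s}) + of_bool (Q {p, r, s}) + of_bool (Q {p, q, s}) + of_bool (Q {p, q, r})"
proof -
  have d: "{p, q, r, s} - {p} = {q, r, s}" "{p, q, r, s} - {q} = {p, r, s}"
    "{p, q, r, s} - {r} = {p, q, s}" "{p, q, r, s} - {s} = {p, q, r}"
    using assms by auto
  have "card {u \<in> {p, q, r, s}. Q ({p, q, r, s} - {u})}
      = (\<Sum>u\<in>{p, q, r, s}. if Q ({p, q, r, s} - {u}) then 1 else 0)"
    by (simp add: sum.inter_filter[symmetric] del: sum.insert)
  also have "\<dots> = of_bool (Q {q, r, s}) + of_bool (Q {p, r, s}) + of_bool (Q {p, q, s}) + of_bool (Q {p, q, r})"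
    using assms by (simp add: d del: insert_Diff_single)
  finally show ?thesis .
qed

text \<open>For \<open>w = 4\<close>, the 4-sets of shape 3+1, 2+2 and 2+1+1 with respect to the blocks contain
  3, 4 and 2 triples of the middle colour, so they would need three different colours out of the two
  that are compatible with such a triple.\<close>

lemma no_chain_colouring_4: "\<not> chain_colouring n 4 c"
proof
  assume "chain_colouring n 4 c"
  then interpret chain_colouring_ge2 n 4 c
    by (simp add: chain_colouring_ge2_def chain_colouring_ge2_axioms_def)
  have "chain_colouring n 3 down" using chain_colouring_down by simp
  then obtain \<beta> where bal: "balanced_blocks n \<beta>"
    and mid: "\<And>x. x \<in> johnson_vertices n 3 \<Longrightarrow> down x = 1 \<longleftrightarrow> card (\<beta> ` x) = 2"
    using chain_colouring_3_blocks by blast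
  obtain k where k: "k \<ge> 3" "\<And>p. p \<in> {1..n} \<Longrightarrow> card {q \<in> {1..n}. \<beta> q = \<beta> p} = k"
    and 3: "3 \<le> card (\<beta> ` {1..n})"
    using bal by (auto simp: balanced_blocks_def)
  obtain A B D where ABD: "A \<in> \<beta> ` {1..n}" "B \<in> \<beta> ` {1..n}" "D \<in> \<beta> ` {1..n}" "A \<noteq> B" "A \<noteq> D" "B \<noteq> D"
    using card_ge_3E[OF 3] .
  let ?S = "\<lambda>L. {q \<in> {1..n}. \<beta> q = L}"
  have big: "3 \<le> card (?S L)" if L: "L \<in> \<beta> ` {1..n}" for L
  proof -
    obtain p where p: "p \<in> {1..n}" "L = \<beta> p" using L by (rule imageE)
    show ?thesis unfolding p(2) k(2)[OF p(1)] by (rule k(1))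
  qed
  obtain a1 a2 a3 where "a1 \<in> ?S A" "a2 \<in> ?S A" "a3 \<in> ?S A" and aa: "a1 \<noteq> a2" "a1 \<noteq> a3" "a2 \<noteq> a3"
    using card_ge_3E[OF big[OF ABD(1)]] .
  then have "a1 \<in> {1..n}" "a2 \<in> {1..n}" "a3 \<in> {1..n}" "\<beta> a1 = A" "\<beta> a2 = A" "\<beta> a3 = A" by blast+
  note a = this aa
  obtain b1 b2 b3 where "b1 \<in> ?S B" "b2 \<in> ?S B" "b3 \<in> ?S B" and bb: "b1 \<noteq> b2" "b1 \<noteq> b3" "b2 \<noteq> b3"
    using card_ge_3E[OF big[OF ABD(2)]] .
  then have "b1 \<in> {1..n}" "b2 \<in> {1..n}" "\<beta> b1 = B" "\<beta> b2 = B" by blast+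
  note b = this bb(1)
  obtain d where d: "d \<in> {1..n}" "D = \<beta> d" using ABD(3) by (rule imageE)
  note d = d(1) d(2)[symmetric]
  have dist: "a1 \<noteq> b1" "a2 \<noteq> b1" "a3 \<noteq> b1" "a1 \<noteq> b2" "a2 \<noteq> b2" "a1 \<noteq> d" "a2 \<noteq> d" "b1 \<noteq> d"
    using a b d ABD by blast+
  have low: "lower x 1 = card {u \<in> x. card (\<beta> ` (x - {u})) = 2}" if x: "x \<in> johnson_vertices n 4" for x
  proof -
    have "down (x - {u}) = 1 \<longleftrightarrow> card (\<beta> ` (x - {u})) = 2" if "u \<in> x" for u
      using mid[of "x - {u}"] remove_vertex[OF x that] by simp
    then have "{u \<in> x. down (x - {u}) = 1} = {u \<in> x. card (\<beta> ` (x - {u})) = 2}" by blast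
    then show ?thesis unfolding lower_def by (simp only:)
  qed
  have col: "c x = 1 \<or> c x = 2" if x: "x \<in> johnson_vertices n 4" and pos: "lower x 1 \<noteq> 0" for x
  proof -
    have "{u \<in> x. down (x - {u}) = 1} \<noteq> {}" using pos unfolding lower_def by (metis card.empty)
    then obtain u where "u \<in> x" "down (x - {u}) = 1" by blast
    then show ?thesis using colour_cases[OF x, of u] by auto
  qed
  let ?x1 = "{a1, a2, a3, b1}" and ?x2 = "{a1, a2, b1, b2}" and ?x3 = "{a1, a2, b1, d}"
  have x: "?x1 \<in> johnson_vertices n 4" "?x2 \<in> johnson_vertices n 4" "?x3 \<in> johnson_vertices n 4"
    using a b d ABD dist by (auto simp: johnson_vertices_def)
  have l: "lower ?x1 1 = 3" "lower ?x2 1 = 4" "lower ?x3 1 = 2"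
    unfolding low[OF x(1)] low[OF x(2)] low[OF x(3)]
    by (subst card_filter_remove_4; simp add: card_image_triple a b d ABD dist not_sym[OF ABD(4)]
        not_sym[OF ABD(5)] not_sym[OF ABD(6)] del: image_insert One_nat_def)+
  have "c ?x1 \<noteq> c ?x2" "c ?x1 \<noteq> c ?x3" "c ?x2 \<noteq> c ?x3"
    using lower_eq[OF x(1,2), of 1] lower_eq[OF x(1,3), of 1] lower_eq[OF x(2,3), of 1] unfolding l by auto
  then show False using col[OF x(1)] col[OF x(2)] col[OF x(3)] unfolding l by auto
qed

lemma no_chain_colouring:
  assumes "4 \<le> w"
  shows "\<not> chain_colouring n w c"
  using assms
proof (induction w arbitrary: c rule: dec_induct)
  case base
  then show ?case by (rule no_chain_colouring_4)
next
  case (step w)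
  show ?case
  proof
    assume "chain_colouring n (Suc w) c"
    then interpret chain_colouring_ge2 n "Suc w" c
      using step.hyps by (simp add: chain_colouring_ge2_def chain_colouring_ge2_axioms_def)
    show False using chain_colouring_down step.IH by simp
  qed
qed

lemma chain_colouring_of_code:
  assumes cr: "completely_regular n w C" and rad: "covering_radius n w C = w - 1"
    and str: "strength n w C = 1" and w: "1 \<le> w"
  shows "chain_colouring n w (code_dist n w C)"
proof -
  let ?V = "johnson_vertices n w" and ?c = "code_dist n w C"
  have C: "C \<subseteq> ?V" "C \<noteq> {}" using cr by (auto simp: completely_regular_def)
  let ?I = "{i. layer n w C i \<noteq> {}}"
  have fin: "finite ?I"
    using code_dist_le_card[OF C] by (intro finite_subset[of ?I "{..w}"]) (auto simp: layer_code_dist)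
  have ne: "?I \<noteq> {}" using C by (auto simp: layer_code_dist)
  have max: "Max ?I = w - 1" using rad by (simp add: covering_radius_def)
  show ?thesis
  proof
    show "?c x < w" if "x \<in> ?V" for x
    proof -
      have "?c x \<in> ?I" using that by (auto simp: layer_code_dist)
      then have "?c x \<le> w - 1" using Max_ge[OF fin] max by metis
      then show ?thesis using w by simp
    qed
    have "w - 1 \<in> ?I" using Max_in[OF fin ne] max by simp
    then obtain x where "x \<in> ?V" "?c x = w - 1" by (auto simp: layer_code_dist)
    then show "\<exists>x\<in>?V. ?c x + 1 = w" using w by (intro bexI[of _ x]) auto
  next
    fix x m assume "x \<in> ?V" "m \<in> moves n x"
    then show "?c (exchange x m) \<le> ?c x + 1"
      using code_dist_lipschitz[OF C exchange_edge] by blast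
  next
    fix x assume x: "x \<in> ?V" "?c x > 0"
    obtain y where y: "(x, y) \<in> johnson_edges n w" "?c y + 1 = ?c x"
      using code_dist_descent[OF C x] by blast
    obtain m where "m \<in> moves n x" "y = exchange x m" using edge_exchange[OF y(1)] .
    then show "\<exists>m\<in>moves n x. ?c (exchange x m) + 1 = ?c x" using y(2) by blast
  next
    obtain \<alpha> \<beta> \<gamma> where reg: "\<And>i x. x \<in> layer n w C i \<Longrightarrow>
        card (nbrs_in n w x (layer n w C i)) = \<alpha> i \<and>
        card (nbrs_in n w x (layer n w C (i + 1))) = \<beta> i \<and>
        (i > 0 \<longrightarrow> card (nbrs_in n w x (layer n w C (i - 1))) = \<gamma> i)"
      using cr unfolding completely_regular_def by blast
    have count: "card {m \<in> moves n x. ?c (exchange x m) = j} =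
      (if j = ?c x then \<alpha> j else if j = ?c x + 1 then \<beta> (?c x) else if j + 1 = ?c x then \<gamma> (?c x) else 0)"
      if x: "x \<in> ?V" for x j
    proof -
      have "{y. (x, y) \<in> johnson_edges n w \<and> ?c y = j} = nbrs_in n w x (layer n w C j)"
        by (auto simp: nbrs_in_def layer_code_dist johnson_edges_def)
      then have n: "card {m \<in> moves n x. ?c (exchange x m) = j} = card (nbrs_in n w x (layer n w C j))"
        using card_neighbours[OF x, of "\<lambda>y. ?c y = j"] by simp
      have xl: "x \<in> layer n w C (?c x)" using x by (simp add: layer_code_dist)
      consider "j = ?c x" | "j = ?c x + 1" | "j + 1 = ?c x" | "j > ?c x + 1 \<or> ?c x > j + 1" by linarith
      then show ?thesis
      proof cases
        case 4
        have "(x, y) \<notin> johnson_edges n w" if "?c y = j" for y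
          using code_dist_lipschitz[OF C, of x y] code_dist_lipschitz[OF C johnson_edges_sym, of x y] 4 that
          by auto
        then have "nbrs_in n w x (layer n w C j) = {}" by (auto simp: nbrs_in_def layer_code_dist)
        then show ?thesis using n 4 by auto
      next
        case 3
        then have "j = ?c x - 1" "?c x > 0" by auto
        then show ?thesis using reg[OF xl] n by auto
      qed (use reg[OF xl] n in auto)
    qed
    show "card {m \<in> moves n x. ?c (exchange x m) = j} = card {m \<in> moves n y. ?c (exchange y m) = j}"
      if "x \<in> ?V" "y \<in> ?V" "?c x = ?c y" for x y j
      unfolding count[OF that(1)] count[OF that(2)] that(3) ..
  next
    let ?T = "{t. t \<le> w \<and> is_design n t C}"
    have "{x \<in> C. T \<subseteq> x} = C" if "T \<subseteq> {1..n}" "card T = 0" for T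
      using that finite_subset[OF that(1)] by auto
    then have "is_design n 0 C" unfolding is_design_def by metis
    then have "?T \<noteq> {}" by blast
    moreover have "finite ?T" by simp
    ultimately have M: "Max ?T \<in> ?T" by (intro Max_in)
    have "Max ?T = 1" using str unfolding strength_def .
    from M[unfolded this] have "is_design n 1 C" by simp
    then obtain l where l: "\<forall>T. T \<subseteq> {1..n} \<and> card T = 1 \<longrightarrow> card {x \<in> C. T \<subseteq> x} = l"
      unfolding is_design_def by (rule exE)
    have "card {x \<in> ?V. p \<in> x \<and> ?c x = 0} = l" if "p \<in> {1..n}" for p
    proof -
      have "{x \<in> ?V. p \<in> x \<and> ?c x = 0} = {x \<in> C. {p} \<subseteq> x}" using code_dist_0_iff[OF C] C(1) by blast
      then show ?thesis using l[rule_format, of "{p}"] that by simp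
    qed
    then show "\<exists>l. \<forall>p\<in>{1..n}. card {x \<in> ?V. p \<in> x \<and> ?c x = 0} = l" by blast
  qed
qed

lemma type_GP2_of_code:
  assumes "completely_regular n 3 C" "covering_radius n 3 C = 2" "strength n 3 C = 1"
  shows "type_GP2 n C \<or> type_GP2 n (opposite_code n 3 C)"
proof -
  have C: "C \<subseteq> johnson_vertices n 3" "C \<noteq> {}" using assms by (auto simp: completely_regular_def)
  have "chain_colouring n 3 (code_dist n 3 C)"
    using assms by (intro chain_colouring_of_code) auto
  then obtain \<beta> \<epsilon> where b: "balanced_blocks n \<beta>" and \<epsilon>: "\<epsilon> \<in> {0, 2}"
    and e: "\<And>x. x \<in> johnson_vertices n 3 \<Longrightarrow> code_dist n 3 C x = \<epsilon> \<longleftrightarrow> card (\<beta> ` x) = 1"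
    using chain_colouring_3_blocks by blast
  have "C = {x \<in> johnson_vertices n 3. code_dist n 3 C x = 0}" using code_dist_0_iff[OF C] C(1) by blast
  moreover have "opposite_code n 3 C = {x \<in> johnson_vertices n 3. code_dist n 3 C x = 2}"
    using assms(2) by (simp add: opposite_code_def layer_code_dist)
  moreover have "{x \<in> johnson_vertices n 3. code_dist n 3 C x = \<epsilon>}
      = {x \<in> johnson_vertices n 3. card (\<beta> ` x) = 1}" using e by blast
  ultimately show ?thesis using type_GP2_of_blocks[OF b] \<epsilon> by auto
qed

lemma type_GP4_pair_shadow:
  assumes "type_GP2 n C"
  shows "type_GP4 n (pair_shadow C)"
proof -
  obtain q k P where q: "q \<ge> 3" "k \<ge> 3" and P: "equipartition n q k P"
    and C: "C = {x. card x = 3 \<and> (\<exists>Y\<in>P. x \<subseteq> Y)}"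
    using assms by (auto simp: type_GP2_def)
  have "(\<exists>y\<in>C. x \<subseteq> y) \<longleftrightarrow> (\<exists>Y\<in>P. x \<subseteq> Y)" if x: "card x = 2" for x
  proof
    assume "\<exists>Y\<in>P. x \<subseteq> Y"
    then obtain Y where Y: "Y \<in> P" "x \<subseteq> Y" by blast
    then have cY: "card Y = k" using P by (simp add: equipartition_def)
    have "\<not> Y \<subseteq> x"
    proof
      assume "Y \<subseteq> x"
      then have "Y = x" using Y(2) by blast
      then show False using cY x q by simp
    qed
    then obtain z where z: "z \<in> Y" "z \<notin> x" by blast
    have "finite x" using x by (metis card.infinite zero_neq_numeral)
    then have "insert z x \<in> C" using z x Y by (auto simp: C)
    then show "\<exists>y\<in>C. x \<subseteq> y" by blast
  qed (auto simp: C)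
  then have "pair_shadow C = {x. card x = 2 \<and> (\<exists>Y\<in>P. x \<subseteq> Y)}" unfolding pair_shadow_def by blast
  moreover have "q \<ge> 2" using q by simp
  ultimately show ?thesis unfolding type_GP4_def using q(2) P by blast
qed

section \<open>The code of triples inside blocks\<close>

context
  fixes n k :: nat and \<beta> :: "nat \<Rightarrow> nat set"
  assumes k: "3 \<le> k" "\<And>p. p \<in> {1..n} \<Longrightarrow> card {q \<in> {1..n}. \<beta> q = \<beta> p} = k"
    and three_blocks: "3 \<le> card (\<beta> ` {1..n})"
begin

lemma card_image_bounds:
  assumes "x \<in> johnson_vertices n 3"
  shows "1 \<le> card (\<beta> ` x)" "card (\<beta> ` x) \<le> 3"
proof -
  obtain p q r where x: "x = {p, q, r}" using johnson_vertices_3E[OF assms] by metis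
  show "1 \<le> card (\<beta> ` x)" "card (\<beta> ` x) \<le> 3" unfolding x card_image_triple by auto
qed

lemma card_image_lipschitz:
  assumes "(x, y) \<in> johnson_edges n w"
  shows "card (\<beta> ` x) \<le> card (\<beta> ` y) + 1"
proof -
  have y: "y \<in> johnson_vertices n w" using assms by (simp add: johnson_edges_def)
  obtain m where m: "m \<in> moves n y" "x = exchange y m"
    using edge_exchange[OF johnson_edges_sym[OF assms]] .
  have "\<beta> ` x \<subseteq> insert (\<beta> (snd m)) (\<beta> ` y)" unfolding m(2) exchange_def by blast
  moreover have fin: "finite (\<beta> ` y)" using finite_vertex[OF y] by simp
  ultimately have "card (\<beta> ` x) \<le> card (insert (\<beta> (snd m)) (\<beta> ` y))" by (intro card_mono) simp_all
  also have "\<dots> \<le> card (\<beta> ` y) + 1" using fin by (simp add: card_insert_if)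
  finally show ?thesis .
qed

lemma block_mate:
  assumes "q \<in> {1..n}"
  obtains v where "v \<in> {1..n}" "\<beta> v = \<beta> q" "v \<noteq> q" "v \<noteq> r"
proof -
  have "\<not> {v \<in> {1..n}. \<beta> v = \<beta> q} \<subseteq> {q, r}"
  proof
    assume "{v \<in> {1..n}. \<beta> v = \<beta> q} \<subseteq> {q, r}"
    then have "k \<le> card {q, r}" unfolding k(2)[OF assms, symmetric] by (intro card_mono) simp_all
    also have "\<dots> \<le> 2" by (simp add: card_insert_if)
    finally show False using k(1) by simp
  qed
  then show ?thesis using that by blast
qed

lemma card_image_descent_aux:
  assumes x: "{p, q, r} \<in> johnson_vertices n 3" and d: "p \<noteq> q" "p \<noteq> r" "q \<noteq> r"
    and b: "\<beta> p \<noteq> \<beta> q" "\<beta> p \<noteq> \<beta> r"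
  shows "\<exists>y. ({p, q, r}, y) \<in> johnson_edges n 3 \<and> card (\<beta> ` y) + 1 = card (\<beta> ` {p, q, r})"
proof -
  have "q \<in> {1..n}" using x by (simp add: johnson_vertices_def)
  then obtain v where v: "v \<in> {1..n}" "\<beta> v = \<beta> q" "v \<noteq> q" "v \<noteq> r" using block_mate by blast
  have "v \<noteq> p" using v b by metis
  then have "(p, v) \<in> moves n {p, q, r}" using v by (simp add: moves_def)
  moreover have "exchange {p, q, r} (p, v) = {v, q, r}" using d by (auto simp: exchange_def)
  ultimately have "({p, q, r}, {v, q, r}) \<in> johnson_edges n 3" using exchange_edge[OF x] by metis
  moreover have "card (\<beta> ` {v, q, r}) + 1 = card (\<beta> ` {p, q, r})"
    unfolding card_image_triple using b v(2) by simp
  ultimately show ?thesis by blast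
qed

lemma card_image_descent:
  assumes x: "x \<in> johnson_vertices n 3" and pos: "1 < card (\<beta> ` x)"
  shows "\<exists>y. (x, y) \<in> johnson_edges n 3 \<and> card (\<beta> ` y) + 1 = card (\<beta> ` x)"
proof -
  obtain p q r where pqr: "x = {p, q, r}" "p \<noteq> q" "p \<noteq> r" "q \<noteq> r" using johnson_vertices_3E[OF x] by metis
  have perm: "{q, p, r} = x" "{r, p, q} = x" unfolding pqr(1) by blast+
  consider "\<beta> p \<noteq> \<beta> q" "\<beta> p \<noteq> \<beta> r" | "\<beta> q \<noteq> \<beta> p" "\<beta> q \<noteq> \<beta> r" | "\<beta> r \<noteq> \<beta> p" "\<beta> r \<noteq> \<beta> q"
    using pos unfolding pqr(1) card_image_triple by (auto split: if_splits)
  then show ?thesis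
  proof cases
    case 1
    then show ?thesis using card_image_descent_aux[of p q r] x pqr by simp
  next
    case 2
    show ?thesis using card_image_descent_aux[of q p r, unfolded perm] x pqr(2-4) 2 by simp
  next
    case 3
    show ?thesis using card_image_descent_aux[of r p q, unfolded perm] x pqr(2-4) 3 by simp
  qed
qed

lemma card_blocks_union:
  assumes r: "r \<subseteq> {1..n}"
  shows "card {v \<in> {1..n}. \<beta> v \<in> \<beta> ` r} = k * card (\<beta> ` r)"
proof -
  have fin: "finite r" using r by (rule finite_subset) simp
  have "{v \<in> {1..n}. \<beta> v \<in> \<beta> ` r} = (\<Union>b\<in>\<beta> ` r. {v \<in> {1..n}. \<beta> v = b})" by blast
  also have "card \<dots> = (\<Sum>b\<in>\<beta> ` r. card {v \<in> {1..n}. \<beta> v = b})"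
    using fin by (intro card_UN_disjoint) auto
  also have "\<dots> = (\<Sum>b\<in>\<beta> ` r. k)"
  proof (rule sum.cong[OF refl])
    fix b assume "b \<in> \<beta> ` r"
    then obtain p where p: "b = \<beta> p" "p \<in> r" by (rule imageE)
    then have "p \<in> {1..n}" using r by blast
    then show "card {v \<in> {1..n}. \<beta> v = b} = k" unfolding p(1) by (rule k(2))
  qed
  finally show ?thesis by simp
qed

lemma card_extensions:
  assumes x: "x \<in> johnson_vertices n 3" and u: "u \<in> x"
  shows "card {v \<in> {1..n} - x. card (\<beta> ` insert v (x - {u})) = j}
    = (let b = card (\<beta> ` (x - {u})); s = k * b - (if card (\<beta> ` x) = b then 3 else 2)
       in if j = b then s else if j = b + 1 then n - 3 - s else 0)"
proof -
  define r where "r = x - {u}"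
  have xX: "x \<subseteq> {1..n}" "card x = 3" "finite x" using x finite_vertex[OF x] by (simp_all add: johnson_vertices_def)
  have r: "r \<subseteq> {1..n}" "card r = 2" "finite r" "x = insert u r" "u \<notin> r" using xX u by (auto simp: r_def)
  let ?S = "{v \<in> {1..n} - x. \<beta> v \<in> \<beta> ` r}"
  have "{z \<in> x. \<beta> z \<in> \<beta> ` r} = (if \<beta> u \<in> \<beta> ` r then insert u r else r)" unfolding r(4) by auto
  moreover have "card (\<beta> ` x) = (if \<beta> u \<in> \<beta> ` r then card (\<beta> ` r) else Suc (card (\<beta> ` r)))"
    unfolding r(4) using r(3) by (simp add: card_insert_if)
  ultimately have cx: "card {z \<in> x. \<beta> z \<in> \<beta> ` r} = (if card (\<beta> ` x) = card (\<beta> ` r) then 3 else 2)"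
    using r by auto
  have "?S = {v \<in> {1..n}. \<beta> v \<in> \<beta> ` r} - {z \<in> x. \<beta> z \<in> \<beta> ` r}" by blast
  moreover have "card ({v \<in> {1..n}. \<beta> v \<in> \<beta> ` r} - {z \<in> x. \<beta> z \<in> \<beta> ` r})
      = card {v \<in> {1..n}. \<beta> v \<in> \<beta> ` r} - card {z \<in> x. \<beta> z \<in> \<beta> ` r}"
    using xX by (intro card_Diff_subset) auto
  ultimately have S: "card ?S = k * card (\<beta> ` r) - (if card (\<beta> ` x) = card (\<beta> ` r) then 3 else 2)"
    unfolding cx card_blocks_union[OF r(1)] by simp
  have "{v \<in> {1..n} - x. \<beta> v \<notin> \<beta> ` r} = ({1..n} - x) - ?S" by blast
  moreover have "card (({1..n} - x) - ?S) = card ({1..n} - x) - card ?S" by (intro card_Diff_subset) auto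
  moreover have "card ({1..n} - x) = n - 3" using xX by (simp add: card_Diff_subset)
  ultimately have T: "card {v \<in> {1..n} - x. \<beta> v \<notin> \<beta> ` r} = n - 3 - card ?S" by simp
  have "card (\<beta> ` insert v r) = (if \<beta> v \<in> \<beta> ` r then card (\<beta> ` r) else card (\<beta> ` r) + 1)" for v
    using r(3) by (simp add: card_insert_if)
  then have "{v \<in> {1..n} - x. card (\<beta> ` insert v r) = j}
    = (if j = card (\<beta> ` r) then ?S
       else if j = card (\<beta> ` r) + 1 then {v \<in> {1..n} - x. \<beta> v \<notin> \<beta> ` r} else {})"
    by auto
  then have "card {v \<in> {1..n} - x. card (\<beta> ` insert v r) = j}
    = (if j = card (\<beta> ` r) then card ?S else if j = card (\<beta> ` r) + 1 then n - 3 - card ?S else 0)"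
    unfolding T[symmetric] by (simp only: card.empty if_distrib[of card])
  then show ?thesis unfolding Let_def r_def[symmetric] S .
qed

lemma card_moves_blocks:
  assumes x: "x \<in> johnson_vertices n 3"
  shows "card {m \<in> moves n x. card (\<beta> ` exchange x m) = j}
    = (\<Sum>u\<in>x. card {v \<in> {1..n} - x. card (\<beta> ` insert v (x - {u})) = j})"
proof -
  have "{m \<in> moves n x. card (\<beta> ` exchange x m) = j}
      = (SIGMA u:x. {v \<in> {1..n} - x. card (\<beta> ` insert v (x - {u})) = j})"
    by (auto simp: moves_def exchange_def)
  then show ?thesis using finite_vertex[OF x] by (simp add: card_SigmaI)
qed

lemma blocks_equitable:
  obtains H where "\<And>x j. x \<in> johnson_vertices n 3 \<Longrightarrow>
    card {m \<in> moves n x. card (\<beta> ` exchange x m) = j} = H (card (\<beta> ` x)) j"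
proof -
  define G where "G b a j = (let s = k * b - (if a = b then 3 else 2)
       in if j = b then s else if j = b + 1 then n - 3 - s else 0)" for b a j :: nat
  define H where "H a j = (if a = 1 then 3 * G 1 1 j else if a = 2 then G 1 2 j + 2 * G 2 2 j
     else 3 * G 2 3 j)" for a j :: nat
  have "card {m \<in> moves n x. card (\<beta> ` exchange x m) = j} = H (card (\<beta> ` x)) j"
    if x: "x \<in> johnson_vertices n 3" for x j
  proof -
    have eq: "card {m \<in> moves n x. card (\<beta> ` exchange x m) = j}
      = (\<Sum>u\<in>x. G (card (\<beta> ` (x - {u}))) (card (\<beta> ` x)) j)"
      unfolding card_moves_blocks[OF x]
      using card_extensions[OF x] by (intro sum.cong refl) (simp only: G_def Let_def)
    obtain p q r where pqr: "x = {p, q, r}" "p \<noteq> q" "p \<noteq> r" "q \<noteq> r" using johnson_vertices_3E[OF x] by metis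
    have d: "{p, q, r} - {p} = {q, r}" "{p, q, r} - {q} = {p, r}" "{p, q, r} - {r} = {p, q}"
      using pqr by auto
    have two: "card (\<beta> ` {a, b}) = (if \<beta> a = \<beta> b then 1 else 2)" for a b by simp
    have "(\<Sum>u\<in>x. G (card (\<beta> ` (x - {u}))) (card (\<beta> ` x)) j)
      = G (card (\<beta> ` {q, r})) (card (\<beta> ` x)) j + G (card (\<beta> ` {p, r})) (card (\<beta> ` x)) j
        + G (card (\<beta> ` {p, q})) (card (\<beta> ` x)) j"
      unfolding pqr(1) using pqr(2-4)
      by (simp add: d del: insert_Diff_single image_insert)
    then show ?thesis unfolding eq unfolding pqr(1) card_image_triple two H_def by auto
  qed
  then show ?thesis using that by blast
qed

lemma block_triples:
  obtains a1 a2 a3 b d where "a1 \<in> {1..n}" "a2 \<in> {1..n}" "a3 \<in> {1..n}" "b \<in> {1..n}" "d \<in> {1..n}"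
    "a1 \<noteq> a2" "a1 \<noteq> a3" "a2 \<noteq> a3" "\<beta> a2 = \<beta> a1" "\<beta> a3 = \<beta> a1"
    "\<beta> b \<noteq> \<beta> a1" "\<beta> d \<noteq> \<beta> a1" "\<beta> b \<noteq> \<beta> d"
proof -
  obtain A B D where ABD: "A \<in> \<beta> ` {1..n}" "B \<in> \<beta> ` {1..n}" "D \<in> \<beta> ` {1..n}" "A \<noteq> B" "A \<noteq> D" "B \<noteq> D"
    using card_ge_3E[OF three_blocks] .
  obtain a where a: "A = \<beta> a" "a \<in> {1..n}" using ABD(1) by (rule imageE)
  obtain b where b: "B = \<beta> b" "b \<in> {1..n}" using ABD(2) by (rule imageE)
  obtain d where d: "D = \<beta> d" "d \<in> {1..n}" using ABD(3) by (rule imageE)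
  obtain a2 where a2: "a2 \<in> {1..n}" "\<beta> a2 = \<beta> a" "a2 \<noteq> a" using block_mate[OF a(2)] by metis
  obtain a3 where a3: "a3 \<in> {1..n}" "\<beta> a3 = \<beta> a" "a3 \<noteq> a" "a3 \<noteq> a2" using block_mate[OF a(2)] by metis
  show ?thesis
    by (rule that[of a a2 a3 b d]) (use a b d a2 a3 ABD in auto)
qed

lemma blocks_code:
  defines "C \<equiv> {x \<in> johnson_vertices n 3. card (\<beta> ` x) = 1}"
  shows "completely_regular n 3 C" "covering_radius n 3 C = 2" "strength n 3 C = 1"
proof -
  let ?V = "johnson_vertices n 3"
  obtain a1 a2 a3 b d where pts: "a1 \<in> {1..n}" "a2 \<in> {1..n}" "a3 \<in> {1..n}" "b \<in> {1..n}" "d \<in> {1..n}"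
    "a1 \<noteq> a2" "a1 \<noteq> a3" "a2 \<noteq> a3" "\<beta> a2 = \<beta> a1" "\<beta> a3 = \<beta> a1"
    "\<beta> b \<noteq> \<beta> a1" "\<beta> d \<noteq> \<beta> a1" "\<beta> b \<noteq> \<beta> d"
    by (rule block_triples)
  have ne: "b \<noteq> a1" "b \<noteq> a2" "d \<noteq> a1" "b \<noteq> d" using pts by metis+
  have aC: "{a1, a2, a3} \<in> C"
    unfolding C_def using johnson_vertices_3I[OF pts(1-3,6-8)] pts(9,10)
    by (simp add: card_image_triple del: image_insert)
  have dist: "code_dist n 3 C x = card (\<beta> ` x) - 1" if x: "x \<in> ?V" for x
  proof (rule code_dist_eqI[OF _ _ _ x])
    have "card (\<beta> ` x) = 1 \<longleftrightarrow> card (\<beta> ` x) - 1 = 0" if "x \<in> ?V" for x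
      using card_image_bounds(1)[OF that] by linarith
    then show "C = {x \<in> ?V. card (\<beta> ` x) - 1 = 0}" unfolding C_def by (intro Collect_cong conj_cong refl)
    show "card (\<beta> ` x) - 1 \<le> card (\<beta> ` y) - 1 + 1" if "(x, y) \<in> johnson_edges n 3" for x y
      using card_image_lipschitz[OF that] by linarith
    show "\<exists>y. (x, y) \<in> johnson_edges n 3 \<and> card (\<beta> ` y) - 1 + 1 = card (\<beta> ` x) - 1"
      if x: "x \<in> ?V" and pos: "0 < card (\<beta> ` x) - 1" for x
    proof -
      obtain y where y: "(x, y) \<in> johnson_edges n 3" "card (\<beta> ` y) + 1 = card (\<beta> ` x)"
        using card_image_descent[OF x] pos by auto
      have "y \<in> ?V" using y(1) by (simp add: johnson_edges_def)
      then have "card (\<beta> ` y) - 1 + 1 = card (\<beta> ` x) - 1" using card_image_bounds(1)[of y] y(2) by linarith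
      then show ?thesis using y(1) by blast
    qed
  qed
  have lay: "layer n 3 C i = {x \<in> ?V. card (\<beta> ` x) = i + 1}" for i
    unfolding layer_code_dist
  proof (intro Collect_cong conj_cong refl)
    fix x assume x: "x \<in> ?V"
    show "code_dist n 3 C x = i \<longleftrightarrow> card (\<beta> ` x) = i + 1"
      unfolding dist[OF x] using card_image_bounds(1)[OF x] by linarith
  qed
  obtain H where H: "\<And>x j. x \<in> ?V \<Longrightarrow>
    card {m \<in> moves n x. card (\<beta> ` exchange x m) = j} = H (card (\<beta> ` x)) j"
    using blocks_equitable by blast
  have nb: "card (nbrs_in n 3 x (layer n 3 C j)) = H (i + 1) (j + 1)" if "x \<in> layer n 3 C i" for x i j
  proof -
    have x: "x \<in> ?V" "card (\<beta> ` x) = i + 1" using that unfolding lay by auto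
    have "nbrs_in n 3 x (layer n 3 C j) = {y. (x, y) \<in> johnson_edges n 3 \<and> card (\<beta> ` y) = j + 1}"
      unfolding nbrs_in_def lay by (auto simp: johnson_edges_def)
    then show ?thesis using card_neighbours[OF x(1), of "\<lambda>y. card (\<beta> ` y) = j + 1"] H[OF x(1)] x(2) by simp
  qed
  have "\<forall>i. \<forall>x\<in>layer n 3 C i.
      card (nbrs_in n 3 x (layer n 3 C i)) = H (i + 1) (i + 1) \<and>
      card (nbrs_in n 3 x (layer n 3 C (i + 1))) = H (i + 1) (i + 1 + 1) \<and>
      (i > 0 \<longrightarrow> card (nbrs_in n 3 x (layer n 3 C (i - 1))) = H (i + 1) (i - 1 + 1))"
    using nb by blast
  moreover have "C \<subseteq> ?V" unfolding C_def by blast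
  ultimately show "completely_regular n 3 C"
    unfolding completely_regular_def using aC
    by (intro conjI exI[of _ "\<lambda>i. H (i + 1) (i + 1)"] exI[of _ "\<lambda>i. H (i + 1) (i + 1 + 1)"]
        exI[of _ "\<lambda>i. H (i + 1) (i - 1 + 1)"]) auto
  show "covering_radius n 3 C = 2"
    unfolding covering_radius_def
  proof (rule Max_eqI)
    have le: "i \<le> 2" if "layer n 3 C i \<noteq> {}" for i
    proof -
      obtain x where "x \<in> layer n 3 C i" using \<open>layer n 3 C i \<noteq> {}\<close> by blast
      then have "x \<in> ?V" "card (\<beta> ` x) = i + 1" unfolding lay by auto
      then show ?thesis using card_image_bounds(2)[of x] by simp
    qed
    have "{i. layer n 3 C i \<noteq> {}} \<subseteq> {..2}"
    proof
      fix i assume "i \<in> {i. layer n 3 C i \<noteq> {}}"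
      then have "i \<le> 2" by (intro le) (rule CollectD)
      then show "i \<in> {..2}" by (rule atMost_iff[THEN iffD2])
    qed
    then show "finite {i. layer n 3 C i \<noteq> {}}" by (rule finite_subset) simp
    show "i \<le> 2" if "i \<in> {i. layer n 3 C i \<noteq> {}}" for i by (rule le[OF CollectD[OF that]])
    have "{a1, b, d} \<in> ?V"
      by (rule johnson_vertices_3I[OF pts(1,4,5) not_sym[OF ne(1)] not_sym[OF ne(3)] ne(4)])
    moreover have "card (\<beta> ` {a1, b, d}) = 2 + 1"
      unfolding card_image_triple using pts(11-13) by simp
    ultimately have "{a1, b, d} \<in> layer n 3 C 2" unfolding lay by (intro CollectI conjI)
    then show "2 \<in> {i. layer n 3 C i \<noteq> {}}" by blast
  qed
  have des1: "is_design n 1 C"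
    unfolding is_design_def
  proof (intro exI allI impI)
    fix T assume T: "T \<subseteq> {1..n} \<and> card T = 1"
    then obtain p where p: "T = {p}" "p \<in> {1..n}" by (metis card_1_singletonE insert_subset)
    let ?F = "{q \<in> {1..n}. \<beta> q = \<beta> p}"
    have fin: "finite (?F - {p})" by simp
    have "{x \<in> C. T \<subseteq> x} = insert p ` {s. s \<subseteq> ?F - {p} \<and> card s = 2}"
    proof (intro equalityI subsetI)
      fix x assume "x \<in> {x \<in> C. T \<subseteq> x}"
      then have x: "x \<in> ?V" "card (\<beta> ` x) = 1" "p \<in> x" using p by (auto simp: C_def)
      have xX: "x \<subseteq> {1..n}" "card x = 3" "finite x" using x(1) finite_vertex[OF x(1)] by (simp_all add: johnson_vertices_def)
      obtain L where L: "\<forall>q\<in>x. \<beta> q = L" using x card_image_eq_1_iff[of x \<beta>] by blast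
      then have "x - {p} \<subseteq> ?F - {p}" using x(3) xX by auto
      moreover have "card (x - {p}) = 2" using xX x(3) by simp
      moreover have "x = insert p (x - {p})" using x(3) by blast
      ultimately show "x \<in> insert p ` {s. s \<subseteq> ?F - {p} \<and> card s = 2}" by blast
    next
      fix x assume "x \<in> insert p ` {s. s \<subseteq> ?F - {p} \<and> card s = 2}"
      then obtain s where s: "x = insert p s" "s \<subseteq> ?F - {p}" "card s = 2" by blast
      have "finite s" using s(2) fin by (rule finite_subset)
      then have "card x = 3" using s by (subst s(1), subst card_insert_disjoint) auto
      moreover have "x \<subseteq> {1..n}" using s p by blast
      moreover have "\<forall>q\<in>x. \<beta> q = \<beta> p" using s by blast
      then have "card (\<beta> ` x) = 1" using card_image_eq_1_iff[of x \<beta>] s(1) by blast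
      ultimately show "x \<in> {x \<in> C. T \<subseteq> x}" using p s(1) by (simp add: C_def johnson_vertices_def)
    qed
    moreover have "inj_on (insert p) {s. s \<subseteq> ?F - {p} \<and> card s = 2}"
      by (rule inj_onI) blast
    moreover have "card {s. s \<subseteq> ?F - {p} \<and> card s = 2} = card (?F - {p}) choose 2"
      using fin by (rule n_subsets)
    moreover have "card (?F - {p}) = k - 1" using k(2)[OF p(2)] p(2) by simp
    ultimately show "card {x \<in> C. T \<subseteq> x} = (k - 1) choose 2" by (simp only: card_image)
  qed
  have not_design: "\<not> is_design n t C" if t: "t = 2 \<or> t = 3" for t
  proof
    assume "is_design n t C"
    then obtain l where l: "\<forall>T. T \<subseteq> {1..n} \<and> card T = t \<longrightarrow> card {x \<in> C. T \<subseteq> x} = l"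
      unfolding is_design_def by (rule exE)
    obtain S where S: "S \<subseteq> {1..n}" "card S = t" "S \<subseteq> {a1, a2, a3}"
    proof (cases "t = 2")
      case True
      then show ?thesis using pts by (intro that[of "{a1, a2}"]) simp_all
    next
      case False
      then show ?thesis using t pts by (intro that[of "{a1, a2, a3}"]) simp_all
    qed
    obtain T where T: "T \<subseteq> {1..n}" "card T = t" "a1 \<in> T" "b \<in> T"
    proof (cases "t = 2")
      case True
      then show ?thesis using pts ne by (intro that[of "{b, a1}"]) simp_all
    next
      case False
      then show ?thesis using t pts ne by (intro that[of "{b, a1, a2}"]) simp_all
    qed
    have "finite {x \<in> C. S \<subseteq> x}" unfolding C_def by simp
    moreover have "{a1, a2, a3} \<in> {x \<in> C. S \<subseteq> x}" using aC S(3) by blast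
    ultimately have "card {x \<in> C. S \<subseteq> x} > 0" by (rule card_pos)
    then have "l > 0" using l[rule_format, of S] S(1,2) by simp
    have notC: "x \<notin> C" if "T \<subseteq> x" for x
    proof
      assume "x \<in> C"
      moreover have "a1 \<in> x" "b \<in> x" using that T(3,4) by blast+
      ultimately have "\<beta> a1 = \<beta> b" using card_image_eq_1_iff[of x \<beta>] unfolding C_def by blast
      then show False using pts(11) by simp
    qed
    have "{x \<in> C. T \<subseteq> x} = {}" using notC by blast
    then have "card {x \<in> C. T \<subseteq> x} = 0" by (simp only: card.empty)
    then show False using \<open>l > 0\<close> l[rule_format, of T] T(1,2) by simp
  qed
  show "strength n 3 C = 1"
    unfolding strength_def
  proof (rule Max_eqI)
    show "finite {t. t \<le> 3 \<and> is_design n t C}" by simp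
    show "t \<le> 1" if "t \<in> {t. t \<le> 3 \<and> is_design n t C}" for t
    proof (rule ccontr)
      assume "\<not> t \<le> 1"
      then have "t = 2 \<or> t = 3" using that by auto
      then show False using not_design that by blast
    qed
    show "1 \<in> {t. t \<le> 3 \<and> is_design n t C}" using des1 by simp
  qed
qed

end

lemma code_of_type_GP2:
  assumes "type_GP2 n C"
  shows "completely_regular n 3 C \<and> covering_radius n 3 C = 2 \<and> strength n 3 C = 1"
proof -
  obtain \<beta> where b: "balanced_blocks n \<beta>" and C: "C = {x \<in> johnson_vertices n 3. card (\<beta> ` x) = 1}"
    using blocks_of_type_GP2[OF assms] .
  obtain k where k: "3 \<le> k" "\<And>p. p \<in> {1..n} \<Longrightarrow> card {q \<in> {1..n}. \<beta> q = \<beta> p} = k"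
    "3 \<le> card (\<beta> ` {1..n})"
    using b by (auto simp: balanced_blocks_def)
  show ?thesis unfolding C using blocks_code[OF k] by blast
qed

theorem theorem5:
  "(\<forall>n C. 2 * 3 \<le> n \<and> completely_regular n 3 C \<and> covering_radius n 3 C = 2 \<and> strength n 3 C = 1
       \<longrightarrow> type_GP4 n (pair_shadow C) \<or> type_GP4 n (pair_shadow (opposite_code n 3 C)))
   \<and> (\<forall>n C. 2 * 3 \<le> n \<and> completely_regular n 3 C \<and> covering_radius n 3 C = 2 \<and> strength n 3 C = 1
       \<longrightarrow> type_GP2 n C \<or> type_GP2 n (opposite_code n 3 C))
   \<and> (\<forall>n C. 2 * 3 \<le> n \<and> type_GP2 n C
       \<longrightarrow> completely_regular n 3 C \<and> covering_radius n 3 C = 2 \<and> strength n 3 C = 1)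
   \<and> (\<forall>n w C. 4 \<le> w \<and> 2 * w \<le> n
       \<longrightarrow> \<not> (completely_regular n w C \<and> covering_radius n w C = w - 1 \<and> strength n w C = 1))"
proof (intro conjI allI impI)
  fix n C assume "2 * 3 \<le> n \<and> completely_regular n 3 C \<and> covering_radius n 3 C = 2 \<and> strength n 3 C = 1"
  then have "type_GP2 n C \<or> type_GP2 n (opposite_code n 3 C)" using type_GP2_of_code by blast
  then show "type_GP2 n C \<or> type_GP2 n (opposite_code n 3 C)"
    "type_GP4 n (pair_shadow C) \<or> type_GP4 n (pair_shadow (opposite_code n 3 C))"
    using type_GP4_pair_shadow by blast+
next
  fix n C assume "2 * 3 \<le> n \<and> type_GP2 n C"
  then show "completely_regular n 3 C" "covering_radius n 3 C = 2" "strength n 3 C = 1"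
    using code_of_type_GP2 by blast+
next
  fix n w :: nat and C assume w: "4 \<le> w \<and> 2 * w \<le> n"
  show "\<not> (completely_regular n w C \<and> covering_radius n w C = w - 1 \<and> strength n w C = 1)"
  proof
    assume "completely_regular n w C \<and> covering_radius n w C = w - 1 \<and> strength n w C = 1"
    then have "chain_colouring n w (code_dist n w C)" using w by (intro chain_colouring_of_code) auto
    then show False using no_chain_colouring[of w] w by blast
  qed
qed

end
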